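(* Let $X=(t,u,c)\in\mathfrak g$. Then, for each $z\in\mathbb C^n$, $$S_\lambda(d\pi(X))(z)=d\chi(t)+i\lambda c+\tfrac\lambda2(\bar uz-\bar zu)-\tfrac\lambda2\,i\,\bar z(\alpha(t)z)$$ and $$W_0(d\pi(X))(z)=d\chi(t)+i\lambda c+\tfrac\lambda2(\bar uz-\bar zu)+\tfrac12\,i\sum_{k=1}^n\alpha_k(t)(1-\lambda|z_k|^2).$$
   Context: Fix integers $n,m\ge 1$ and $\lambda>0$. For $z,w\in\mathbb C^n$ put $zw:=\sum_k z_kw_k$ (bilinear), $|z|^2=z\bar z$, and $\omega((z,w),(z',w')):=\tfrac i2(zw'-z'w)$. Let $\alpha_1,\dots,\alpha_n$ be linear forms on $\mathbb R^m$; for $t\in\mathbb R^m$, $t\cdot z=(e^{i\alpha_1(t)}z_1,\dots,e^{i\alpha_n(t)}z_n)$, $\alpha(t)z=(\alpha_1(t)z_1,\dots,\alpha_n(t)z_n)$, and $t^{-1}$ means $-t$. The generalized diamond group $G$ is $\mathbb R^m\times\mathbb C^n\times\mathbb R$ with $(t,z,c)\cdot(t',z',c')=(t+t',\,z+t\cdot z',\,c+c'+\tfrac12\omega((z,\bar z),(t\cdot z',\overline{t\cdot z'})))$. Its Lie algebra $\mathfrak g$ consists of $(t,u,c)\in\mathbb R^m\times\mathbb C^n\times\mathbb R$ (tangent space at the identity), with bracket $[(t,u,c),(t',u',c')]=(0,i(\alpha(t)u'-\alpha(t')u),\omega((u,\bar u),(u',\bar u')))$. $\mathcal F_\lambda$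 is the Hilbert space of holomorphic $f$ on $\mathbb C^n$ with $\int_{\mathbb C^n}|f(z)|^2e^{-\lambda|z|^2/2}d\mu_\lambda(z)<\infty$, $d\mu_\lambda=(2\pi)^{-n}\lambda^n\,dx\,dy$, $z=x+iy$. Fix a unitary character $\chi$ of $\mathbb R^m$ with differential $d\chi$ at $0$ (so $\chi(t)=e^{d\chi(t)}$). The unitary representation $\pi$ of $G$ on $\mathcal F_\lambda$ is $(\pi(t,z_0,c_0)f)(z)=\chi(t)\exp(i\lambda c_0+\tfrac\lambda2\bar z_0z-\tfrac\lambda4|z_0|^2)f(t^{-1}\cdot(z-z_0))$, and $d\pi(X)f=\frac{d}{ds}\pi(\exp(sX))f\big|_{s=0}$ is its derived representation (defined in particular on coherent states). Coherent states: $e_z(w)=\exp(\lambda\bar zw/2)$. For an operator $A$ defined on coherent states, $k_A(z,w)=\langle Ae_w,e_z\rangle$, the Berezin symbol is $S_\lambda(A)(z)=\langle Ae_z,e_z\rangle/\langle e_z,e_z\rangle$, and the complex Weyl symbol is, whenever the integral converges, $$W_0(A)(z)=2^n\int_{\mathbb C^n}k_A(z+w,z-w)\exp\left(\tfrac\lambda2(-z\bar z-w\bar w+z\bar w-\bar zw)\right)d\mu_\lambda(w).$$ *)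

theory Defs
  imports "HOL-Analysis.Analysis"
begin

text \<open>
  Throughout, \<open>complex ^ 'n\<close> is complex n-space and \<open>real ^ 'm\<close> is real m-space.
  The parameters are \<open>lam\<close> (the positive number lambda), the linear forms
  \<open>alpha k\<close> on \<open>real ^ 'm\<close>, and the unitary character \<open>chi\<close> of \<open>real ^ 'm\<close>.
\<close>

definition cnj_vec :: "complex ^ 'n \<Rightarrow> complex ^ 'n" where
  "cnj_vec z = (\<chi> k. cnj (z $ k))"

text \<open>The bilinear (not sesquilinear) product \<open>zw\<close>.\<close>

definition bil :: "complex ^ 'n::finite \<Rightarrow> complex ^ 'n \<Rightarrow> complex" where
  "bil z w = (\<Sum>k\<in>UNIV. z $ k * w $ k)"

lemma bil_cnj_vec_self: "bil z (cnj_vec z) = complex_of_real ((norm z)\<^sup>2)"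
  unfolding bil_def cnj_vec_def norm_vec_def L2_set_def
  by (simp add: sum_nonneg complex_norm_square flip: of_real_power)

definition omega ::
    "(complex ^ 'n::finite) \<times> (complex ^ 'n) \<Rightarrow> (complex ^ 'n) \<times> (complex ^ 'n) \<Rightarrow> complex" where
  "omega p q = \<i> / 2 * (bil (fst p) (snd q) - bil (fst q) (snd p))"

lemma omega_cnj_vec_real: "omega (z, cnj_vec z) (w, cnj_vec w) \<in> \<real>"
proof -
  have "cnj (bil z (cnj_vec w)) = bil w (cnj_vec z)" "cnj (bil w (cnj_vec z)) = bil z (cnj_vec w)"
    by (simp_all add: bil_def cnj_vec_def mult.commute)
  then have "cnj (omega (z, cnj_vec z) (w, cnj_vec w)) = omega (z, cnj_vec z) (w, cnj_vec w)"
    unfolding omega_def by (auto simp: algebra_simps)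
  then show ?thesis by (simp add: Reals_cnj_iff)
qed

subsection \<open>The generalized diamond group\<close>

definition torus_act ::
    "('n::finite \<Rightarrow> real ^ 'm::finite \<Rightarrow> real) \<Rightarrow> real ^ 'm \<Rightarrow> complex ^ 'n \<Rightarrow> complex ^ 'n" where
  "torus_act alpha t z = (\<chi> k. exp (\<i> * complex_of_real (alpha k t)) * z $ k)"

definition alpha_mult ::
    "('n::finite \<Rightarrow> real ^ 'm::finite \<Rightarrow> real) \<Rightarrow> real ^ 'm \<Rightarrow> complex ^ 'n \<Rightarrow> complex ^ 'n" where
  "alpha_mult alpha t z = (\<chi> k. complex_of_real (alpha k t) * z $ k)"

text \<open>
  The same type carries the group and, as its tangent space at the identity, the Lie algebra.
\<close>

type_synonym ('m, 'n) diamond = "(real ^ 'm) \<times> (complex ^ 'n) \<times> real"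

text \<open>The value of \<open>omega\<close> below is real by \<open>omega_cnj_vec_real\<close>; \<open>Re\<close> is only a coercion.\<close>

fun diamond_mult ::
    "('n::finite \<Rightarrow> real ^ 'm::finite \<Rightarrow> real) \<Rightarrow> ('m, 'n) diamond \<Rightarrow> ('m, 'n) diamond \<Rightarrow> ('m, 'n) diamond"
  where
  "diamond_mult alpha (t, z, c) (t', z', c') =
     (t + t',
      z + torus_act alpha t z',
      c + c' + 1 / 2 * Re (omega (z, cnj_vec z) (torus_act alpha t z', cnj_vec (torus_act alpha t z'))))"

text \<open>
  A homomorphism from the additive reals that is differentiable at 0 is automatically smooth, so
  this is the usual notion of a one-parameter subgroup with initial velocity \<open>X\<close>.
\<close>

definition one_parameter_subgroup ::
    "('n::finite \<Rightarrow> real ^ 'm::finite \<Rightarrow> real) \<Rightarrow> ('m, 'n) diamond \<Rightarrow> (real \<Rightarrow> ('m, 'n) diamond) \<Rightarrow> bool"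
  where
  "one_parameter_subgroup alpha X g \<longleftrightarrow>
     (\<forall>r s. g (r + s) = diamond_mult alpha (g r) (g s)) \<and> (g has_vector_derivative X) (at 0)"

definition diamond_exp ::
    "('n::finite \<Rightarrow> real ^ 'm::finite \<Rightarrow> real) \<Rightarrow> ('m, 'n) diamond \<Rightarrow> ('m, 'n) diamond" where
  "diamond_exp alpha X = (THE g. one_parameter_subgroup alpha X g) 1"

definition unitary_character :: "(real ^ 'm::finite \<Rightarrow> complex) \<Rightarrow> bool" where
  "unitary_character chi \<longleftrightarrow>
     continuous_on UNIV chi \<and> (\<forall>s t. chi (s + t) = chi s * chi t) \<and> (\<forall>t. norm (chi t) = 1)"

subsection \<open>The Fock space\<close>

text \<open>Holomorphy in several variables: the real derivative exists and is complex linear.\<close>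

definition holomorphic_vec :: "(complex ^ 'n::finite \<Rightarrow> complex) \<Rightarrow> bool" where
  "holomorphic_vec f \<longleftrightarrow>
     (\<forall>z. \<exists>D. (f has_derivative D) (at z) \<and> (\<forall>a v. D (a *s v) = a * D v))"

definition fock_measure :: "real \<Rightarrow> (complex ^ 'n::finite) measure" where
  "fock_measure lam = density lborel (\<lambda>_. ennreal ((lam / (2 * pi)) ^ CARD('n)))"

definition fock_space :: "real \<Rightarrow> (complex ^ 'n::finite \<Rightarrow> complex) set" where
  "fock_space lam =
     {f. holomorphic_vec f \<and>
         integrable (fock_measure lam) (\<lambda>z. (norm (f z))\<^sup>2 * exp (- lam * (norm z)\<^sup>2 / 2))}"

definition fock_inner ::
    "real \<Rightarrow> (complex ^ 'n::finite \<Rightarrow> complex) \<Rightarrow> (complex ^ 'n \<Rightarrow> complex) \<Rightarrow> complex" where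
  "fock_inner lam f g =
     (\<integral>z. f z * cnj (g z) * complex_of_real (exp (- lam * (norm z)\<^sup>2 / 2)) \<partial>fock_measure lam)"

definition fock_norm :: "real \<Rightarrow> (complex ^ 'n::finite \<Rightarrow> complex) \<Rightarrow> real" where
  "fock_norm lam f = sqrt (Re (fock_inner lam f f))"

definition coherent :: "real \<Rightarrow> complex ^ 'n::finite \<Rightarrow> complex ^ 'n \<Rightarrow> complex" where
  "coherent lam z w = exp (complex_of_real lam * bil (cnj_vec z) w / 2)"

subsection \<open>The representation and its derived representation\<close>

fun diamond_rep ::
    "('n::finite \<Rightarrow> real ^ 'm::finite \<Rightarrow> real) \<Rightarrow> (real ^ 'm \<Rightarrow> complex) \<Rightarrow> real \<Rightarrow>
     ('m, 'n) diamond \<Rightarrow> (complex ^ 'n \<Rightarrow> complex) \<Rightarrow> complex ^ 'n \<Rightarrow> complex" where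
  "diamond_rep alpha chi lam (t, z0, c0) f z =
     chi t *
     exp (\<i> * complex_of_real lam * complex_of_real c0
          + complex_of_real lam / 2 * bil (cnj_vec z0) z
          - complex_of_real lam / 4 * complex_of_real ((norm z0)\<^sup>2)) *
     f (torus_act alpha (- t) (z - z0))"

text \<open>
  \<open>h\<close> is the derivative at \<open>s = 0\<close> of the orbit map \<open>s \<mapsto> \<pi>(exp (s X)) f\<close>, the limit of the
  difference quotients being taken in the norm of the Fock space.
\<close>

definition has_derived_rep ::
    "('n::finite \<Rightarrow> real ^ 'm::finite \<Rightarrow> real) \<Rightarrow> (real ^ 'm \<Rightarrow> complex) \<Rightarrow> real \<Rightarrow>
     ('m, 'n) diamond \<Rightarrow> (complex ^ 'n \<Rightarrow> complex) \<Rightarrow> (complex ^ 'n \<Rightarrow> complex) \<Rightarrow> bool" where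
  "has_derived_rep alpha chi lam X f h \<longleftrightarrow>
     f \<in> fock_space lam \<and> h \<in> fock_space lam \<and>
     ((\<lambda>s. fock_norm lam
         (\<lambda>z. (diamond_rep alpha chi lam (diamond_exp alpha (s *\<^sub>R X)) f z - f z) / complex_of_real s
              - h z)) \<longlongrightarrow> 0) (at 0)"

definition derived_domain ::
    "('n::finite \<Rightarrow> real ^ 'm::finite \<Rightarrow> real) \<Rightarrow> (real ^ 'm \<Rightarrow> complex) \<Rightarrow> real \<Rightarrow>
     ('m, 'n) diamond \<Rightarrow> (complex ^ 'n \<Rightarrow> complex) set" where
  "derived_domain alpha chi lam X = {f. \<exists>!h. has_derived_rep alpha chi lam X f h}"

definition derived_rep ::
    "('n::finite \<Rightarrow> real ^ 'm::finite \<Rightarrow> real) \<Rightarrow> (real ^ 'm \<Rightarrow> complex) \<Rightarrow> real \<Rightarrow>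
     ('m, 'n) diamond \<Rightarrow> (complex ^ 'n \<Rightarrow> complex) \<Rightarrow> (complex ^ 'n \<Rightarrow> complex)" where
  "derived_rep alpha chi lam X f = (THE h. has_derived_rep alpha chi lam X f h)"

subsection \<open>Symbols of operators\<close>

text \<open>
  A possibly unbounded operator is a map on functions; only its values on coherent states matter.
\<close>

type_synonym 'n fock_operator = "(complex ^ 'n \<Rightarrow> complex) \<Rightarrow> (complex ^ 'n \<Rightarrow> complex)"

definition op_kernel ::
    "real \<Rightarrow> ('n::finite) fock_operator \<Rightarrow> complex ^ 'n \<Rightarrow> complex ^ 'n \<Rightarrow> complex" where
  "op_kernel lam A z w = fock_inner lam (A (coherent lam w)) (coherent lam z)"

definition berezin_symbol ::
    "real \<Rightarrow> ('n::finite) fock_operator \<Rightarrow> complex ^ 'n \<Rightarrow> complex" where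
  "berezin_symbol lam A z =
     fock_inner lam (A (coherent lam z)) (coherent lam z)
     / fock_inner lam (coherent lam z) (coherent lam z)"

definition weyl_integrand ::
    "real \<Rightarrow> ('n::finite) fock_operator \<Rightarrow> complex ^ 'n \<Rightarrow> complex ^ 'n \<Rightarrow> complex" where
  "weyl_integrand lam A z w =
     op_kernel lam A (z + w) (z - w) *
     exp (complex_of_real lam / 2 *
          (- bil z (cnj_vec z) - bil w (cnj_vec w) + bil z (cnj_vec w) - bil (cnj_vec z) w))"

text \<open>
  The Bochner integral is 0 when it does not converge, so convergence is a separate predicate.
\<close>

definition weyl_converges ::
    "real \<Rightarrow> ('n::finite) fock_operator \<Rightarrow> complex ^ 'n \<Rightarrow> bool" where
  "weyl_converges lam A z \<longleftrightarrow> integrable (fock_measure lam) (weyl_integrand lam A z)"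

definition weyl_symbol ::
    "real \<Rightarrow> ('n::finite) fock_operator \<Rightarrow> complex ^ 'n \<Rightarrow> complex" where
  "weyl_symbol lam A z = 2 ^ CARD('n) * (\<integral>w. weyl_integrand lam A z w \<partial>fock_measure lam)"

end

theory Submission
  imports Defs "HOL-Probability.Characteristic_Functions"
begin

text \<open>
  Along the one-parameter subgroup of \<open>X = (t, u, c)\<close> the coherent state at \<open>w\<close> is moved to
  \<open>\<kappa>(s) exp (q(s) v)\<close> with \<open>\<kappa>\<close> and \<open>q\<close> differentiable at 0, so that \<open>d\<pi>(X)\<close> sends it to the
  state times an affine function of \<open>v\<close>. The convergence of the difference quotients is dominated by a
  function of exponential growth, hence holds in the norm of the Fock space. Coherent states
  reproduce the values of such functions, by an explicit Gaussian integral for pure exponentials and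
  by differentiation in the parameters for the affine factor. In the Weyl integrand at \<open>z\<close>
  the exponentials collapse to \<open>exp (- \<lambda> |w|\<^sup>2)\<close>, and what remains are the Gaussian
  moments of a polynomial of degree two in \<open>w\<close> and its conjugate: the constant part gives the
  Berezin symbol, the linear part is odd, and \<open>|w\<^sub>k|\<^sup>2\<close> has mean \<open>1 / \<lambda>\<close>.
\<close>

subsection \<open>Gaussian integrals\<close>

text \<open>Two definite descriptions stand between the definitions and any computation:
  \<open>diamond_exp\<close> names a one-parameter subgroup and \<open>derived_rep\<close> a limit
  in the Fock norm, and each needs existence and uniqueness. For the subgroup, the group law is
  triangular, so uniqueness reduces to successive integration and existence to an explicit curve;
  afterwards only its value and velocity at 0 matter. For the limit, uniqueness rests on the
  continuity of holomorphic functions, since the integral sees them only almost everywhere. A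
  further gap is the character: it is assumed continuous only, and differentiability has to be
  extracted from the functional equation before \<open>frechet_derivative chi (at 0)\<close> means
  anything. The term that separates the two symbols comes from a sign: in the product of
  \<open>cnj_vec (z - w)\<close> with \<open>z + w\<close> the squares of \<open>z\<close> and of
  \<open>w\<close> enter with opposite signs.\<close>

lemma has_bochner_integral_exp_gaussian:
  fixes \<beta> :: complex and a :: real
  assumes "a > 0"
  shows "has_bochner_integral lborel (\<lambda>x::real. exp (\<beta> * of_real x - of_real (a * x\<^sup>2)))
           (of_real (sqrt (pi / a)) * exp (\<beta>\<^sup>2 / of_real (4 * a)))"
proof -
  \<comment> \<open>\<open>\<sigma>\<close> is the standard deviation of the density proportional to
    \<open>exp (- a * x\<^sup>2)\<close>, and \<open>p / (2 * a)\<close> is the point where the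
    modulus of the integrand peaks. The substitution \<open>p / (2 * a) + \<sigma> * x\<close>
    completes the square in the real part \<open>p\<close>; the imaginary part \<open>q\<close> then
    enters as the characteristic function of the standard normal distribution at
    \<open>q * \<sigma>\<close>.\<close>
  define p q \<sigma> where "p = Re \<beta>" and "q = Im \<beta>" and "\<sigma> = 1 / sqrt (2 * a)"
  have \<sigma>: "\<sigma> > 0" "\<sigma>\<^sup>2 = 1 / (2 * a)" using assms by (auto simp: \<sigma>_def power_divide)
  have \<beta>: "\<beta> = of_real p + \<i> * of_real q" by (simp add: p_def q_def complex_eq)
  have int: "integrable std_normal_distribution (\<lambda>x. iexp (q * \<sigma> * x))"
    by (rule finite_measure.integrable_const_bound[where B=1])
      (auto intro!: prob_space.finite_measure[OF prob_space_normal_density])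
  then have "has_bochner_integral std_normal_distribution (\<lambda>x. iexp (q * \<sigma> * x))
      (of_real (exp (- (q * \<sigma>)\<^sup>2 / 2)))"
    using fun_cong[OF char_std_normal_distribution, of "q * \<sigma>"]
    by (simp add: has_bochner_integral_iff char_def)
  then have "has_bochner_integral lborel (\<lambda>x. std_normal_density x *\<^sub>R iexp (q * \<sigma> * x))
      (of_real (exp (- (q * \<sigma>)\<^sup>2 / 2)))"
    by (simp only: has_bochner_integral_iff) (simp add: integral_density integrable_density)
  then have "has_bochner_integral lborel
      (\<lambda>x. exp (of_real (p\<^sup>2 / (4 * a)) + \<i> * of_real (q * p / (2 * a))) * of_real (sqrt (2 * pi)) *
         (std_normal_density x *\<^sub>R iexp (q * \<sigma> * x)))
      (exp (of_real (p\<^sup>2 / (4 * a)) + \<i> * of_real (q * p / (2 * a))) * of_real (sqrt (2 * pi)) *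
         of_real (exp (- (q * \<sigma>)\<^sup>2 / 2)))"
    by (intro has_bochner_integral_mult_right) auto
  also have "(\<lambda>x. exp (of_real (p\<^sup>2 / (4 * a)) + \<i> * of_real (q * p / (2 * a))) * of_real (sqrt (2 * pi)) *
         (std_normal_density x *\<^sub>R iexp (q * \<sigma> * x))) =
      (\<lambda>x. exp (\<beta> * of_real (p / (2 * a) + \<sigma> * x) - of_real (a * (p / (2 * a) + \<sigma> * x)\<^sup>2)))"
  proof
    fix x :: real
    have "a * (p / (2 * a) + \<sigma> * x)\<^sup>2 = p\<^sup>2 / (4 * a) + p * \<sigma> * x + a * \<sigma>\<^sup>2 * x\<^sup>2"
      using assms by (simp add: field_simps power2_eq_square)
    also have "\<dots> = p\<^sup>2 / (4 * a) + p * \<sigma> * x + x\<^sup>2 / 2"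
      using assms unfolding \<sigma>(2) by simp
    finally have 1: "a * (p / (2 * a) + \<sigma> * x)\<^sup>2 = p\<^sup>2 / (4 * a) + p * \<sigma> * x + x\<^sup>2 / 2" .
    have p: "p\<^sup>2 / (2 * a) = p\<^sup>2 / (4 * a) + p\<^sup>2 / (4 * a)" using assms by (simp add: field_simps)
    have 2: "\<beta> * of_real (p / (2 * a) + \<sigma> * x) - of_real (a * (p / (2 * a) + \<sigma> * x)\<^sup>2) =
      (of_real (p\<^sup>2 / (4 * a)) + \<i> * of_real (q * p / (2 * a))) + of_real (- x\<^sup>2 / 2) + \<i> * of_real (q * \<sigma> * x)"
      unfolding 1 \<beta> by (simp only: complex_eq_iff) (use assms p in \<open>simp add: power2_eq_square distrib_left\<close>)
    show "exp (of_real (p\<^sup>2 / (4 * a)) + \<i> * of_real (q * p / (2 * a))) * of_real (sqrt (2 * pi)) *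
         (std_normal_density x *\<^sub>R iexp (q * \<sigma> * x)) =
      exp (\<beta> * of_real (p / (2 * a) + \<sigma> * x) - of_real (a * (p / (2 * a) + \<sigma> * x)\<^sup>2))"
      unfolding 2 exp_add by (simp add: std_normal_density_def scaleR_conv_of_real flip: exp_of_real)
  qed
  also have "exp (of_real (p\<^sup>2 / (4 * a)) + \<i> * of_real (q * p / (2 * a))) * of_real (sqrt (2 * pi)) *
         of_real (exp (- (q * \<sigma>)\<^sup>2 / 2)) =
      of_real (sqrt (pi / a)) * exp (\<beta>\<^sup>2 / of_real (4 * a)) /\<^sub>R \<bar>\<sigma>\<bar>"
  proof -
    have q: "- (q * \<sigma>)\<^sup>2 / 2 = - (q\<^sup>2 / (4 * a))" using \<sigma> by (simp add: power_mult_distrib)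
    have "of_real (p\<^sup>2 / (4 * a)) + \<i> * of_real (q * p / (2 * a)) + of_real (- (q\<^sup>2 / (4 * a)))
        = (of_real p + \<i> * of_real q)\<^sup>2 / of_real (4 * a)"
      using assms by (simp add: power2_eq_square field_simps)
    then have 1: "exp (of_real (p\<^sup>2 / (4 * a)) + \<i> * of_real (q * p / (2 * a))) * of_real (exp (- (q * \<sigma>)\<^sup>2 / 2))
        = exp (\<beta>\<^sup>2 / of_real (4 * a))"
      unfolding exp_of_real[symmetric] exp_add[symmetric] q \<beta> by (rule arg_cong)
    have 2: "sqrt (2 * pi) = sqrt (pi / a) / \<bar>\<sigma>\<bar>"
      using assms by (simp add: \<sigma>_def real_sqrt_divide real_sqrt_mult)
    have "x * of_real (r / \<bar>\<sigma>\<bar>) * y = of_real r * (x * y) /\<^sub>R \<bar>\<sigma>\<bar>" for x y :: complex and r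
      by (simp add: scaleR_conv_of_real divide_inverse)
    then show ?thesis unfolding 1[symmetric] 2 .
  qed
  finally show ?thesis
    using \<sigma> by (subst lborel_has_bochner_integral_real_affine_iff[where c=\<sigma> and t="p / (2 * a)"]) simp_all
qed

text \<open>The variance \<open>1 / (2 * a)\<close> of the centred normal density, with the
  normalising factor multiplied back.\<close>

lemma has_bochner_integral_gaussian_second_moment:
  fixes a :: real
  assumes "a > 0"
  shows "has_bochner_integral lborel (\<lambda>x::real. x\<^sup>2 * exp (- a * x\<^sup>2)) (sqrt (pi / a) / (2 * a))"
proof -
  define \<sigma> where "\<sigma> = 1 / sqrt (2 * a)"
  have \<sigma>: "\<sigma> > 0" "\<sigma>\<^sup>2 = 1 / (2 * a)" using assms by (auto simp: \<sigma>_def power_divide)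
  have "has_bochner_integral lborel (\<lambda>x. sqrt (2 * pi * \<sigma>\<^sup>2) * (normal_density 0 \<sigma> x * (x - 0) ^ (2 * 1)))
      (sqrt (2 * pi * \<sigma>\<^sup>2) * (fact (2 * 1) / ((2 / \<sigma>\<^sup>2) ^ 1 * fact 1)))"
    by (intro has_bochner_integral_mult_right normal_moment_even[OF \<sigma>(1)])
  also have "(\<lambda>x. sqrt (2 * pi * \<sigma>\<^sup>2) * (normal_density 0 \<sigma> x * (x - 0) ^ (2 * 1))) =
      (\<lambda>x::real. x\<^sup>2 * exp (- a * x\<^sup>2))"
    using assms by (auto simp: normal_density_def \<sigma>)
  also have "sqrt (2 * pi * \<sigma>\<^sup>2) * (fact (2 * 1) / ((2 / \<sigma>\<^sup>2) ^ 1 * fact 1)) = sqrt (pi / a) / (2 * a)"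
    unfolding \<sigma>(2) using assms by simp
  finally show ?thesis .
qed

text \<open>Lebesgue measure is the image of the product measure over \<open>Basis\<close>, so
  Fubini applies to integrands that factor over the coordinates. The value type is general because
  both complex exponentials and real moments are integrated this way.\<close>

lemma has_bochner_integral_lborel_prod:
  fixes f :: "'a::euclidean_space \<Rightarrow> real \<Rightarrow> 'b::{real_normed_field,banach,second_countable_topology}"
  assumes "\<And>b. b \<in> Basis \<Longrightarrow> has_bochner_integral lborel (f b) (I b)"
  shows "has_bochner_integral lborel (\<lambda>v::'a. \<Prod>b\<in>Basis. f b (v \<bullet> b)) (\<Prod>b\<in>Basis. I b)"
proof -
  interpret product_sigma_finite "\<lambda>b::'a. lborel :: real measure" by standard
  have int: "integrable lborel (f b)" "integral\<^sup>L lborel (f b) = I b" if "b \<in> Basis" for b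
    using assms[OF that] by (auto simp: has_bochner_integral_iff)
  have [measurable]: "f b \<in> borel_measurable borel" if "b \<in> Basis" for b
    using int(1)[OF that] by (auto dest: borel_measurable_integrable)
  have "has_bochner_integral (\<Pi>\<^sub>M b\<in>Basis. lborel) (\<lambda>x. \<Prod>b\<in>Basis. f b (x b)) (\<Prod>b\<in>Basis. I b)"
    unfolding has_bochner_integral_iff
    by (intro conjI product_integrable_prod, simp, simp add: int, subst product_integral_prod)
      (auto simp: int)
  also have "(\<lambda>x. \<Prod>b\<in>Basis. f b (x b)) =
      (\<lambda>x. \<Prod>b\<in>Basis. f b ((\<Sum>b'\<in>Basis. x b' *\<^sub>R b') \<bullet> b))"
    by (auto intro!: prod.cong)
  finally show ?thesis
    by (subst lborel_eq, subst has_bochner_integral_distr) auto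
qed

lemma has_bochner_integral_gaussian_component:
  fixes b :: "'a::euclidean_space"
  assumes a: "a > 0" and b: "b \<in> Basis"
  shows "has_bochner_integral lborel (\<lambda>v. (v \<bullet> b)\<^sup>2 * exp (- a * (norm v)\<^sup>2))
           (sqrt (pi / a) ^ DIM('a) / (2 * a))"
proof -
  have 0: "has_bochner_integral lborel (\<lambda>x::real. exp (- a * x\<^sup>2)) (sqrt (pi / a))"
    using has_bochner_integral_Re[OF has_bochner_integral_exp_gaussian[OF a, of 0]]
    by (simp add: Re_exp)
  \<comment> \<open>Every coordinate contributes the mass \<open>sqrt (pi / a)\<close>; the
    coordinate of \<open>b\<close> contributes its variance as an additional factor.\<close>
  have "has_bochner_integral lborel
      (\<lambda>v::'a. \<Prod>b'\<in>Basis. (if b' = b then (v \<bullet> b')\<^sup>2 else 1) * exp (- a * (v \<bullet> b')\<^sup>2))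
      (\<Prod>b'\<in>Basis. sqrt (pi / a) * (if b' = b then 1 / (2 * a) else 1))"
    using 0 has_bochner_integral_gaussian_second_moment[OF a]
    by (intro has_bochner_integral_lborel_prod) auto
  also have "(\<lambda>v::'a. \<Prod>b'\<in>Basis. (if b' = b then (v \<bullet> b')\<^sup>2 else 1) * exp (- a * (v \<bullet> b')\<^sup>2)) =
      (\<lambda>v. (v \<bullet> b)\<^sup>2 * exp (- a * (norm v)\<^sup>2))"
  proof
    fix v :: 'a
    have "(norm v)\<^sup>2 = (\<Sum>b'\<in>Basis. (v \<bullet> b')\<^sup>2)"
      unfolding power2_norm_eq_inner by (subst euclidean_inner) (simp add: power2_eq_square)
    then show "(\<Prod>b'\<in>Basis. (if b' = b then (v \<bullet> b')\<^sup>2 else 1) * exp (- a * (v \<bullet> b')\<^sup>2)) =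
        (v \<bullet> b)\<^sup>2 * exp (- a * (norm v)\<^sup>2)"
      by (simp add: prod.distrib b exp_sum sum_distrib_left)
  qed
  also have "(\<Prod>b'\<in>(Basis::'a set). sqrt (pi / a) * (if b' = b then 1 / (2 * a) else 1)) =
      sqrt (pi / a) ^ DIM('a) / (2 * a)"
    unfolding prod.distrib by (simp add: b)
  finally show ?thesis .
qed

text \<open>Pairs the real coordinates belonging to the real and imaginary part of one complex
  coordinate, so that Gaussian factors can be recombined for each \<open>k\<close>.\<close>

lemma prod_Basis_complex_vec:
  fixes f :: "complex ^ 'n::finite \<Rightarrow> 'b::comm_monoid_mult"
  shows "(\<Prod>b\<in>Basis. f b) = (\<Prod>k\<in>UNIV. f (axis k 1) * f (axis k \<i>))"
proof -
  have Basis_eq: "(Basis :: (complex ^ 'n) set) = (\<lambda>p. axis (fst p) (snd p)) ` (UNIV \<times> {1, \<i>})"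
    by (force simp: Basis_vec_def Basis_complex_def)
  have inj: "inj_on (\<lambda>p. axis (fst p) (snd p) :: complex ^ 'n) (UNIV \<times> {1, \<i>})"
    by (auto simp: inj_on_def axis_eq_axis)
  have "(\<Prod>b\<in>Basis. f b) = (\<Prod>(k, u)\<in>UNIV \<times> {1, \<i>}. f (axis k u))"
    unfolding Basis_eq by (subst prod.reindex[OF inj]) (simp add: comp_def case_prod_beta)
  also have "\<dots> = (\<Prod>k\<in>UNIV. f (axis k 1) * f (axis k \<i>))"
    by (simp add: prod.cartesian_product[symmetric])
  finally show ?thesis .
qed

text \<open>The exponent is a real-linear function \<open>B\<close> of \<open>v\<close>, with the
  values \<open>\<beta> $ k + \<gamma> $ k\<close> and
  \<open>\<i> * (\<beta> $ k - \<gamma> $ k)\<close> on the two real axes of coordinate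
  \<open>k\<close>. The squares of these values add up to
  \<open>4 * \<beta> $ k * \<gamma> $ k\<close>, which is why only the product of
  \<open>\<beta>\<close> and \<open>\<gamma>\<close> survives.\<close>

lemma has_bochner_integral_exp_bil_gaussian:
  fixes \<beta> \<gamma> :: "complex ^ 'n::finite"
  assumes a: "a > 0"
  shows "has_bochner_integral lborel
           (\<lambda>v. exp (bil \<beta> v + bil \<gamma> (cnj_vec v)) * of_real (exp (- a * (norm v)\<^sup>2)))
           (of_real ((pi / a) ^ CARD('n)) * exp (bil \<beta> \<gamma> / of_real a))"
proof -
  define s where "s = complex_of_real (sqrt (pi / a))"
  define B where "B b = (\<Sum>k\<in>UNIV. \<beta> $ k * b $ k + \<gamma> $ k * cnj (b $ k))" for b :: "complex ^ 'n"
  have B_axis: "B (axis k x) = \<beta> $ k * x + \<gamma> $ k * cnj x" for k x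
    by (simp add: B_def axis_def if_distrib cong: if_cong sum.cong)
  have "has_bochner_integral lborel
      (\<lambda>v::complex ^ 'n. \<Prod>b\<in>Basis. exp (B b * of_real (v \<bullet> b) - of_real (a * (v \<bullet> b)\<^sup>2)))
      (\<Prod>b\<in>Basis. s * exp ((B b)\<^sup>2 / of_real (4 * a)))"
    unfolding s_def by (intro has_bochner_integral_lborel_prod has_bochner_integral_exp_gaussian a)
  also have "(\<lambda>v::complex ^ 'n. \<Prod>b\<in>Basis. exp (B b * of_real (v \<bullet> b) - of_real (a * (v \<bullet> b)\<^sup>2))) =
      (\<lambda>v. exp (bil \<beta> v + bil \<gamma> (cnj_vec v)) * of_real (exp (- a * (norm v)\<^sup>2)))"
  proof
    fix v :: "complex ^ 'n"
    have n: "(norm v)\<^sup>2 = (\<Sum>k\<in>UNIV. (cmod (v $ k))\<^sup>2)"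
      by (simp add: norm_vec_def L2_set_def sum_nonneg)
    have k: "exp (B (axis k 1) * of_real (v \<bullet> axis k 1) - of_real (a * (v \<bullet> axis k 1)\<^sup>2)) *
        exp (B (axis k \<i>) * of_real (v \<bullet> axis k \<i>) - of_real (a * (v \<bullet> axis k \<i>)\<^sup>2)) =
        exp (\<beta> $ k * v $ k + \<gamma> $ k * cnj (v $ k) - of_real (a * (cmod (v $ k))\<^sup>2))" for k
      unfolding exp_add[symmetric] B_axis inner_axis cmod_power2
      by (rule arg_cong[of _ _ exp]) (simp add: complex_eq_iff algebra_simps)
    show "(\<Prod>b\<in>Basis. exp (B b * of_real (v \<bullet> b) - of_real (a * (v \<bullet> b)\<^sup>2))) =
      exp (bil \<beta> v + bil \<gamma> (cnj_vec v)) * of_real (exp (- a * (norm v)\<^sup>2))"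
      unfolding prod_Basis_complex_vec k exp_sum[OF finite, symmetric]
      unfolding exp_of_real[symmetric] exp_add[symmetric]
      by (rule arg_cong[of _ _ exp])
        (simp add: n bil_def cnj_vec_def sum.distrib sum_subtractf sum_negf sum_distrib_left)
  qed
  also have "(\<Prod>b\<in>Basis. s * exp ((B b)\<^sup>2 / of_real (4 * a))) =
      of_real ((pi / a) ^ CARD('n)) * exp (bil \<beta> \<gamma> / of_real a)"
  proof -
    have s: "s * s = of_real (pi / a)"
      using a unfolding s_def of_real_mult[symmetric] by simp
    have "(s * exp ((B (axis k 1))\<^sup>2 / of_real (4 * a))) * (s * exp ((B (axis k \<i>))\<^sup>2 / of_real (4 * a))) =
        of_real (pi / a) * exp (\<beta> $ k * \<gamma> $ k / of_real a)" for k
    proof -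
      have "(B (axis k 1))\<^sup>2 / of_real (4 * a) + (B (axis k \<i>))\<^sup>2 / of_real (4 * a) = \<beta> $ k * \<gamma> $ k / of_real a"
        using a unfolding B_axis by (simp add: field_simps power2_eq_square)
      then show ?thesis
        unfolding s[symmetric] by (simp add: exp_add[symmetric] add.commute mult_ac)
    qed
    then show ?thesis
      unfolding prod_Basis_complex_vec
      by (simp only: prod.distrib exp_sum[OF finite, symmetric])
        (simp add: bil_def sum_divide_distrib)
  qed
  finally show ?thesis .
qed

text \<open>Two real coordinates of variance \<open>1 / (2 * a)\<close> each.\<close>

lemma has_bochner_integral_norm_nth_gaussian:
  fixes a :: real and k :: "'n::finite"
  assumes a: "a > 0"
  shows "has_bochner_integral lborel
           (\<lambda>v :: complex ^ 'n. (cmod (v $ k))\<^sup>2 * exp (- a * (norm v)\<^sup>2)) ((pi / a) ^ CARD('n) / a)"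
proof -
  have "has_bochner_integral lborel
      (\<lambda>v :: complex ^ 'n. (v \<bullet> axis k 1)\<^sup>2 * exp (- a * (norm v)\<^sup>2) + (v \<bullet> axis k \<i>)\<^sup>2 * exp (- a * (norm v)\<^sup>2))
      (sqrt (pi / a) ^ DIM(complex ^ 'n) / (2 * a) + sqrt (pi / a) ^ DIM(complex ^ 'n) / (2 * a))"
    by (intro has_bochner_integral_add has_bochner_integral_gaussian_component a)
      (auto simp: Basis_vec_def Basis_complex_def)
  also have "(\<lambda>v :: complex ^ 'n. (v \<bullet> axis k 1)\<^sup>2 * exp (- a * (norm v)\<^sup>2) + (v \<bullet> axis k \<i>)\<^sup>2 * exp (- a * (norm v)\<^sup>2)) =
      (\<lambda>v. (cmod (v $ k))\<^sup>2 * exp (- a * (norm v)\<^sup>2))"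
    by (simp add: inner_axis cmod_power2 algebra_simps)
  also have "sqrt (pi / a) ^ DIM(complex ^ 'n) / (2 * a) + sqrt (pi / a) ^ DIM(complex ^ 'n) / (2 * a) =
      (pi / a) ^ CARD('n) / a"
    using a by (simp add: power_mult mult.commute[of _ 2])
  finally show ?thesis .
qed

subsection \<open>Functions of exponential growth\<close>

text \<open>A class closed under sums and products whose members are integrable against every
  Gaussian. Continuity is built in so that measurability needs no separate argument.\<close>

definition exp_growth :: "('a::euclidean_space \<Rightarrow> 'b::real_normed_vector) \<Rightarrow> bool" where
  "exp_growth f \<longleftrightarrow> continuous_on UNIV f \<and> (\<exists>M R. \<forall>v. norm (f v) \<le> M * exp (R * norm v))"

lemma exp_growthD: "exp_growth f \<Longrightarrow> \<exists>M R. M \<ge> 0 \<and> R \<ge> 0 \<and> (\<forall>v. norm (f v) \<le> M * exp (R * norm v))"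
proof -
  assume "exp_growth f"
  then obtain M R where b: "\<And>v. norm (f v) \<le> M * exp (R * norm v)" by (auto simp: exp_growth_def)
  have "norm (f v) \<le> \<bar>M\<bar> * exp (\<bar>R\<bar> * norm v)" for v
    by (rule order.trans[OF b]) (intro mult_mono, auto intro: mult_right_mono)
  then show ?thesis by (intro exI[of _ "\<bar>M\<bar>"] exI[of _ "\<bar>R\<bar>"]) auto
qed

lemma exp_growth_measurable:
  fixes f :: "'a::euclidean_space \<Rightarrow> 'b::{real_normed_vector, second_countable_topology}"
  shows "exp_growth f \<Longrightarrow> f \<in> borel_measurable borel"
  by (auto simp: exp_growth_def intro: borel_measurable_continuous_onI)

lemma exp_growth_const: "exp_growth (\<lambda>v. c)"
  unfolding exp_growth_def by (intro conjI exI[of _ "norm c"] exI[of _ 0]) auto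

lemma exp_growth_add:
  assumes "exp_growth f" "exp_growth g"
  shows "exp_growth (\<lambda>v. f v + g v)"
proof -
  obtain M R M' R' where b: "M \<ge> 0" "M' \<ge> 0" "\<And>v. norm (f v) \<le> M * exp (R * norm v)"
      "\<And>v. norm (g v) \<le> M' * exp (R' * norm v)"
    using exp_growthD[OF assms(1)] exp_growthD[OF assms(2)] by blast
  have "norm (f v + g v) \<le> (M + M') * exp (max R R' * norm v)" for v
    unfolding distrib_right
    by (intro norm_triangle_mono order.trans[OF b(3)] order.trans[OF b(4)] mult_left_mono b)
      (auto intro: mult_right_mono)
  then show ?thesis using assms unfolding exp_growth_def by (blast intro: continuous_on_add)
qed

lemma exp_growth_mult:
  fixes f g :: "'a::euclidean_space \<Rightarrow> 'b::real_normed_algebra"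
  assumes "exp_growth f" "exp_growth g"
  shows "exp_growth (\<lambda>v. f v * g v)"
proof -
  obtain M R M' R' where b: "M \<ge> 0" "M' \<ge> 0" "\<And>v. norm (f v) \<le> M * exp (R * norm v)"
      "\<And>v. norm (g v) \<le> M' * exp (R' * norm v)"
    using exp_growthD[OF assms(1)] exp_growthD[OF assms(2)] by blast
  have "norm (f v * g v) \<le> (M * M') * exp ((R + R') * norm v)" for v
  proof -
    have "norm (f v * g v) \<le> (M * exp (R * norm v)) * (M' * exp (R' * norm v))"
      by (intro order.trans[OF norm_mult_ineq] mult_mono b) (use b in auto)
    also have "\<dots> = (M * M') * exp ((R + R') * norm v)"
      by (simp add: exp_add distrib_right)
    finally show ?thesis .
  qed
  then show ?thesis using assms unfolding exp_growth_def by (blast intro: continuous_on_mult)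
qed

lemma exp_growth_cmult:
  fixes f :: "'a::euclidean_space \<Rightarrow> 'b::real_normed_algebra"
  assumes "exp_growth f" shows "exp_growth (\<lambda>v. c * f v)"
  by (intro exp_growth_mult exp_growth_const assms)

lemma exp_growth_diff:
  fixes f g :: "'a::euclidean_space \<Rightarrow> 'b::real_normed_algebra_1"
  assumes "exp_growth f" "exp_growth g" shows "exp_growth (\<lambda>v. f v - g v)"
  using exp_growth_add[OF assms(1) exp_growth_cmult[OF assms(2), of "- 1"]] by simp

lemma exp_growth_norm: "exp_growth f \<Longrightarrow> exp_growth (\<lambda>v. norm (f v))"
  unfolding exp_growth_def by (auto intro: continuous_on_norm)

lemma exp_growth_cnj: "exp_growth f \<Longrightarrow> exp_growth (\<lambda>v. cnj (f v))"
  unfolding exp_growth_def by (auto intro: continuous_intros)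

lemma exp_growth_exp_norm: "exp_growth (\<lambda>v::'a::euclidean_space. exp (R * norm v))"
  unfolding exp_growth_def
  by (intro conjI exI[of _ 1] exI[of _ R]) (auto intro!: continuous_intros)

lemma exp_growth_bounded_linear:
  fixes f :: "'a::euclidean_space \<Rightarrow> 'b::real_normed_vector"
  assumes "bounded_linear f" shows "exp_growth f"
proof -
  obtain K where K: "\<And>v. norm (f v) \<le> norm v * K" "K > 0"
    using bounded_linear.pos_bounded[OF assms] by blast
  have "norm v \<le> exp (1 * norm v)" for v :: 'a
    unfolding mult_1 using exp_ge_add_one_self[of "norm v"] by linarith
  then have "norm (f v) \<le> K * exp (1 * norm v)" for v
    using K by (metis mult.commute mult_left_mono order.trans less_imp_le)
  then show ?thesis unfolding exp_growth_def
    using linear_continuous_on[OF assms] by blast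
qed

lemma norm_bil_le: "cmod (bil a b) \<le> norm a * norm b"
proof -
  have "norm (bil a b) \<le> (\<Sum>k\<in>UNIV. \<bar>norm (a $ k)\<bar> * \<bar>norm (b $ k)\<bar>)"
    unfolding bil_def by (intro sum_norm_le) (simp add: norm_mult)
  also have "\<dots> \<le> norm a * norm b"
    unfolding norm_vec_def by (rule L2_set_mult_ineq)
  finally show ?thesis .
qed

lemma bounded_bilinear_bil: "bounded_bilinear (bil :: complex ^ 'n::finite \<Rightarrow> _)"
proof
  show "\<exists>K. \<forall>a b :: complex ^ 'n. norm (bil a b) \<le> norm a * norm b * K"
    by (intro exI[of _ 1]) (simp add: norm_bil_le)
qed (simp_all add: bil_def sum.distrib sum_distrib_left scaleR_sum_right algebra_simps)

lemma exp_growth_bil: "exp_growth (bil q)"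
  by (rule exp_growth_bounded_linear) (rule bounded_bilinear.bounded_linear_right[OF bounded_bilinear_bil])

lemma exp_growth_exp_bil: "exp_growth (\<lambda>v. exp (bil q v))"
proof -
  have "norm (exp (bil q v)) \<le> 1 * exp (norm q * norm v)" for v
    using norm_exp[of "bil q v"] norm_bil_le[of q v]
    by (metis exp_le_cancel_iff mult_1 order.trans)
  moreover have "continuous_on UNIV (\<lambda>v. exp (bil q v))"
    using exp_growth_bil[of q] by (auto simp: exp_growth_def intro!: continuous_intros)
  ultimately show ?thesis unfolding exp_growth_def by blast
qed

text \<open>Half of the Gaussian absorbs the exponential growth; the other half stays as an
  integrable majorant.\<close>

lemma integrable_exp_growth_gaussian:
  fixes f :: "complex ^ 'n::finite \<Rightarrow> 'b::{banach, second_countable_topology, real_normed_algebra_1}"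
  assumes f: "exp_growth f" and a: "a > 0"
  shows "integrable lborel (\<lambda>v. f v * of_real (exp (- a * (norm v)\<^sup>2)))"
proof -
  obtain M R where M: "M \<ge> 0" "\<And>v. norm (f v) \<le> M * exp (R * norm v)"
    using exp_growthD[OF f] by blast
  have [measurable]: "f \<in> borel_measurable borel" by (rule exp_growth_measurable[OF f])
  have "integrable lborel (\<lambda>v :: complex ^ 'n. exp (- (a / 2) * (norm v)\<^sup>2))"
    using has_bochner_integral_Re[OF has_bochner_integral_exp_bil_gaussian[of "a / 2" "0 :: complex ^ 'n" 0]] a
    by (simp add: has_bochner_integral_iff bil_def)
  then have "integrable lborel (\<lambda>v :: complex ^ 'n. M * exp (R\<^sup>2 / (2 * a)) * exp (- (a / 2) * (norm v)\<^sup>2))"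
    by (intro integrable_mult_right)
  then show ?thesis
  proof (rule Bochner_Integration.integrable_bound)
    show "AE v in lborel. norm (f v * of_real (exp (- a * (norm v)\<^sup>2)))
        \<le> norm (M * exp (R\<^sup>2 / (2 * a)) * exp (- (a / 2) * (norm v)\<^sup>2))"
    proof (rule AE_I2)
      fix v :: "complex ^ 'n"
      \<comment> \<open>Young's inequality for \<open>R * norm v\<close>; this is the origin of the
        constant \<open>R\<^sup>2 / (2 * a)\<close>.\<close>
      have "0 \<le> (a * norm v - R)\<^sup>2 / (2 * a)" using a by simp
      also have "\<dots> = a / 2 * (norm v)\<^sup>2 - R * norm v + R\<^sup>2 / (2 * a)"
        using a by (simp add: field_simps power2_eq_square)
      finally have le: "R * norm v + (- a * (norm v)\<^sup>2) \<le> R\<^sup>2 / (2 * a) + (- (a / 2) * (norm v)\<^sup>2)"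
        by (simp add: algebra_simps)
      have "norm (f v * of_real (exp (- a * (norm v)\<^sup>2))) = norm (f v) * exp (- a * (norm v)\<^sup>2)"
        by (simp add: scaleR_conv_of_real[symmetric] mult.commute flip: scaleR_conv_of_real)
          (simp add: of_real_def)
      also have "\<dots> \<le> M * (exp (R * norm v) * exp (- a * (norm v)\<^sup>2))"
        using M(2)[of v] by (simp add: mult.assoc[symmetric] mult_right_mono)
      also have "\<dots> \<le> M * (exp (R\<^sup>2 / (2 * a)) * exp (- (a / 2) * (norm v)\<^sup>2))"
        unfolding exp_add[symmetric] using le M(1) by (intro mult_left_mono) auto
      finally show "norm (f v * of_real (exp (- a * (norm v)\<^sup>2)))
          \<le> norm (M * exp (R\<^sup>2 / (2 * a)) * exp (- (a / 2) * (norm v)\<^sup>2))"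
        using M(1) by (simp add: abs_mult mult.assoc)
    qed
  qed simp
qed

subsection \<open>Differentiation of exponentials in the Fock space\<close>

lemma has_vector_derivative_difference_quotient:
  fixes f :: "real \<Rightarrow> 'a::real_normed_vector"
  assumes "(f has_vector_derivative D) (at 0)"
  shows "((\<lambda>s. (f s - f 0) /\<^sub>R s) \<longlongrightarrow> D) (at 0)"
proof -
  have "((\<lambda>s. norm (f s - f 0 - s *\<^sub>R D) / norm s) \<longlongrightarrow> 0) (at 0)"
    using assms unfolding has_vector_derivative_def has_derivative_at by simp
  moreover have "\<forall>\<^sub>F s in at (0::real). norm (f s - f 0 - s *\<^sub>R D) / norm s = norm ((f s - f 0) /\<^sub>R s - D)"
    unfolding eventually_at_filter
  proof (intro always_eventually allI impI)
    fix s :: real assume "s \<noteq> 0"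
    then have "(f s - f 0) /\<^sub>R s - D = (f s - f 0 - s *\<^sub>R D) /\<^sub>R s"
      by (simp add: scaleR_diff_right)
    then show "norm (f s - f 0 - s *\<^sub>R D) / norm s = norm ((f s - f 0) /\<^sub>R s - D)"
      by (simp add: divide_inverse mult.commute)
  qed
  ultimately have "((\<lambda>s. norm ((f s - f 0) /\<^sub>R s - D)) \<longlongrightarrow> 0) (at 0)"
    by (rule Lim_transform_eventually)
  then show ?thesis by (simp add: tendsto_norm_zero_iff LIM_zero_iff)
qed

text \<open>The norms of the difference quotients tend to \<open>norm D\<close>, so they eventually
  stay below it plus the slack 1. This yields constants independent of \<open>s\<close>, from which
  a dominating function can be built.\<close>

lemma has_vector_derivative_eventually_lipschitz:
  fixes f :: "real \<Rightarrow> 'a::real_normed_vector"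
  assumes "(f has_vector_derivative D) (at 0)"
  shows "\<forall>\<^sub>F s in at 0. norm (f s - f 0) \<le> (norm D + 1) * \<bar>s\<bar>"
proof -
  have "((\<lambda>s. norm ((f s - f 0) /\<^sub>R s)) \<longlongrightarrow> norm D) (at 0)"
    by (intro tendsto_norm has_vector_derivative_difference_quotient assms)
  then have "\<forall>\<^sub>F s in at 0. norm ((f s - f 0) /\<^sub>R s) < norm D + 1"
    by (rule order_tendstoD) simp
  then show ?thesis
    unfolding eventually_at_filter
    by eventually_elim (auto simp: divide_simps mult.commute split: if_splits)
qed

text \<open>Mean value inequality for \<open>exp\<close> on the disc of radius
  \<open>cmod x\<close>.\<close>

lemma norm_exp_minus_1_le: "cmod (exp x - 1) \<le> cmod x * exp (cmod x)"
proof -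
  have "norm (exp x - exp 0) \<le> exp (cmod x) * norm (x - 0)"
  proof (rule field_differentiable_bound[where S = "cball 0 (cmod x)" and f' = exp])
    show "norm (exp y) \<le> exp (cmod x)" if "y \<in> cball 0 (cmod x)" for y
      using that norm_exp[of y] by (auto intro: order.trans)
  qed (auto intro!: derivative_eq_intros)
  then show ?thesis by (simp add: mult.commute)
qed

lemma exp_bil_difference_quotient:
  fixes \<kappa> :: "real \<Rightarrow> complex" and q :: "real \<Rightarrow> complex ^ 'n::finite"
  assumes \<kappa>: "(\<kappa> has_vector_derivative \<kappa>') (at 0)" and q: "(q has_vector_derivative q') (at 0)"
  defines "D \<equiv> \<lambda>s v. (\<kappa> s * exp (bil (q s) v) - \<kappa> 0 * exp (bil (q 0) v)) / of_real s
                  - (\<kappa>' + \<kappa> 0 * bil q' v) * exp (bil (q 0) v)"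
  shows exp_bil_difference_quotient_bound:
      "\<exists>w. exp_growth w \<and> (\<forall>\<^sub>F s in at 0. \<forall>v. norm (D s v) \<le> w v)" (is ?bound)
    and exp_bil_difference_quotient_tendsto: "((\<lambda>s. D s v) \<longlongrightarrow> 0) (at 0)" (is ?lim)
proof -
  define K L Q where "K = cmod \<kappa>' + 1" and "L = norm q' + 1" and "Q = norm (q 0)"
  define h where "h v = (\<kappa>' + \<kappa> 0 * bil q' v) * exp (bil (q 0) v)" for v
  \<comment> \<open>\<open>K\<close> and \<open>L\<close> are the Lipschitz constants of
    \<open>\<kappa>\<close> and \<open>q\<close> at 0. The first summand bounds the increment of
    \<open>\<kappa>\<close>, the second that of the exponential, the last the formal
    derivative.\<close>
  define w where "w v = (K * exp ((Q + L) * norm v) +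
      cmod (\<kappa> 0) * (L * norm v) * exp ((Q + L) * norm v)) + norm (h v)" for v :: "complex ^ 'n"
  have pos: "K \<ge> 0" "L \<ge> 0" "Q \<ge> 0" by (auto simp: K_def L_def Q_def)
  have h: "exp_growth h" unfolding h_def
    by (intro exp_growth_mult exp_growth_add exp_growth_const exp_growth_bil exp_growth_exp_bil)
  have "exp_growth w" unfolding w_def
    by (intro exp_growth_mult exp_growth_add exp_growth_const exp_growth_exp_norm exp_growth_norm
        exp_growth_bounded_linear[OF bounded_linear_ident] h)
  moreover have "\<forall>\<^sub>F s in at 0. \<forall>v. norm (D s v) \<le> w v"
  proof -
    \<comment> \<open>With \<open>\<bar>s\<bar> < 1\<close> the increment of \<open>q\<close> is at
      most \<open>L\<close>, so exponents are bounded without reference to \<open>s\<close>; the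
      factor \<open>\<bar>s\<bar>\<close> is kept only where it cancels the denominator.\<close>
    have "\<forall>\<^sub>F s in at (0::real). s \<noteq> 0 \<and> \<bar>s\<bar> < 1"
      unfolding eventually_at by (intro exI[of _ 1]) (auto simp: dist_real_def)
    with has_vector_derivative_eventually_lipschitz[OF \<kappa>] has_vector_derivative_eventually_lipschitz[OF q]
    show ?thesis
    proof eventually_elim
      case (elim s)
      show "\<forall>v. norm (D s v) \<le> w v"
      proof
        fix v
        have L: "norm (q s - q 0) \<le> L * \<bar>s\<bar>" and K: "cmod (\<kappa> s - \<kappa> 0) \<le> K * \<bar>s\<bar>" and s: "s \<noteq> 0" "\<bar>s\<bar> < 1"
          using elim by (auto simp: K_def L_def)
        have L1: "norm (q s - q 0) \<le> L" using L s pos mult_left_le[of "\<bar>s\<bar>" L] by linarith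
        have "norm (q s) \<le> Q + L"
          using norm_triangle_ineq[of "q 0" "q s - q 0"] L1 by (simp add: Q_def)
        then have "cmod (bil (q s) v) \<le> (Q + L) * norm v"
          using norm_bil_le[of "q s" v] mult_right_mono by (metis norm_ge_zero order.trans)
        then have 1: "cmod (exp (bil (q s) v)) \<le> exp ((Q + L) * norm v)"
          using norm_exp[of "bil (q s) v"] by (meson exp_le_cancel_iff order.trans)
        have b: "cmod (bil (q s - q 0) v) \<le> norm (q s - q 0) * norm v" by (rule norm_bil_le)
        have b1: "cmod (bil (q s - q 0) v) \<le> L * norm v"
          using b L1 by (meson mult_right_mono norm_ge_zero order.trans)
        have b2: "cmod (bil (q s - q 0) v) \<le> L * norm v * \<bar>s\<bar>"
          using b mult_right_mono[OF L norm_ge_zero[of v]] by (simp add: mult_ac)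
        have "cmod (exp (bil (q s - q 0) v) - 1) \<le> (L * norm v * \<bar>s\<bar>) * exp (L * norm v)"
          by (rule order.trans[OF norm_exp_minus_1_le]) (intro mult_mono b2, use b1 pos in auto)
        moreover have "cmod (exp (bil (q 0) v)) \<le> exp (Q * norm v)"
          using norm_exp[of "bil (q 0) v"] norm_bil_le[of "q 0" v]
          unfolding Q_def by (meson exp_le_cancel_iff order.trans)
        ultimately have "cmod (exp (bil (q 0) v)) * cmod (exp (bil (q s - q 0) v) - 1)
            \<le> exp (Q * norm v) * ((L * norm v * \<bar>s\<bar>) * exp (L * norm v))"
          by (intro mult_mono) auto
        moreover have "exp (bil (q s) v) - exp (bil (q 0) v) = exp (bil (q 0) v) * (exp (bil (q s - q 0) v) - 1)"
          by (simp add: bounded_bilinear.diff_left[OF bounded_bilinear_bil] exp_diff right_diff_distrib)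
        moreover have exp_QL: "exp ((Q + L) * norm v) = exp (Q * norm v) * exp (L * norm v)"
          by (simp add: exp_add distrib_right)
        ultimately have 2: "cmod (exp (bil (q s) v) - exp (bil (q 0) v)) \<le> L * norm v * exp ((Q + L) * norm v) * \<bar>s\<bar>"
          by (simp add: norm_mult exp_QL mult_ac)
        \<comment> \<open>The usual product-rule splitting, which separates the increments of
          \<open>\<kappa>\<close> and of the exponential.\<close>
        have "cmod (\<kappa> s * exp (bil (q s) v) - \<kappa> 0 * exp (bil (q 0) v)) =
          cmod ((\<kappa> s - \<kappa> 0) * exp (bil (q s) v) + \<kappa> 0 * (exp (bil (q s) v) - exp (bil (q 0) v)))"
          by (simp add: algebra_simps)
        also have "\<dots> \<le> (K * \<bar>s\<bar>) * exp ((Q + L) * norm v) +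
            cmod (\<kappa> 0) * (L * norm v * exp ((Q + L) * norm v) * \<bar>s\<bar>)"
          by (intro norm_triangle_mono) (unfold norm_mult, intro mult_mono K 1 2; use pos in auto)+
        also have "\<dots> = (w v - norm (h v)) * \<bar>s\<bar>" by (simp add: w_def algebra_simps)
        finally have "cmod ((\<kappa> s * exp (bil (q s) v) - \<kappa> 0 * exp (bil (q 0) v)) / of_real s) \<le> w v - norm (h v)"
          using s by (simp add: norm_divide divide_simps)
        then show "norm (D s v) \<le> w v"
          unfolding D_def h_def[symmetric] using norm_triangle_ineq4 by (meson diff_add_cancel add_right_mono le_diff_eq order.trans)
      qed
    qed
  qed
  ultimately show ?bound by blast
  have "((\<lambda>s. \<kappa> s * exp (bil (q s) v)) has_vector_derivative h v) (at 0)"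
  proof -
    have "((\<lambda>s. bil (q s) v) has_vector_derivative bil q' v) (at 0)"
      by (rule bounded_linear.has_vector_derivative[OF bounded_bilinear.bounded_linear_left[OF bounded_bilinear_bil] q])
    then have "((\<lambda>s. exp (bil (q s) v)) has_vector_derivative bil q' v * exp (bil (q 0) v)) (at 0)"
      using field_vector_diff_chain_at[of "\<lambda>s. bil (q s) v" _ 0 exp "exp (bil (q 0) v)"]
      by (simp add: o_def DERIV_exp)
    from has_vector_derivative_mult[OF \<kappa> this] show ?thesis by (simp add: h_def algebra_simps)
  qed
  from has_vector_derivative_difference_quotient[OF this]
  have "((\<lambda>s. (\<kappa> s * exp (bil (q s) v) - \<kappa> 0 * exp (bil (q 0) v)) / of_real s) \<longlongrightarrow> h v) (at 0)"
    by (simp add: scaleR_conv_of_real divide_inverse mult.commute)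
  then show ?lim unfolding D_def h_def[symmetric] by (simp add: LIM_zero_iff)
qed

text \<open>Limits at \<open>x\<close> are tested on sequences avoiding \<open>x\<close>. The bound
  holds only near \<open>x\<close>, hence each sequence is shifted by an \<open>N\<close> past which
  it satisfies the bound.\<close>

lemma integral_dominated_convergence_at:
  fixes F :: "real \<Rightarrow> 'a \<Rightarrow> 'b::{banach, second_countable_topology}"
  assumes [measurable]: "\<And>s. F s \<in> borel_measurable M" "f \<in> borel_measurable M"
    and w: "integrable M w"
    and bound: "\<forall>\<^sub>F s in at x. \<forall>v. norm (F s v) \<le> w v"
    and lim: "\<And>v. ((\<lambda>s. F s v) \<longlongrightarrow> f v) (at x)"
  shows "((\<lambda>s. integral\<^sup>L M (F s)) \<longlongrightarrow> integral\<^sup>L M f) (at x)"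
  unfolding tendsto_at_iff_sequentially comp_def
proof (intro allI impI)
  fix X :: "nat \<Rightarrow> real" assume "\<forall>i. X i \<in> UNIV - {x}" and "X \<longlonglongrightarrow> x"
  then have X: "filterlim X (at x) sequentially"
    by (auto simp: filterlim_at intro: always_eventually)
  from filterlim_iff[THEN iffD1, OF this, rule_format, OF bound]
  obtain N where N: "\<And>n v. N \<le> n \<Longrightarrow> norm (F (X n) v) \<le> w v"
    by (auto simp: eventually_sequentially)
  show "(\<lambda>n. integral\<^sup>L M (F (X n))) \<longlonglongrightarrow> integral\<^sup>L M f"
  proof (rule LIMSEQ_offset, rule integral_dominated_convergence[OF _ _ w])
    show "AE v in M. norm (F (X (n + N)) v) \<le> w v" for n using N by auto
    show "AE v in M. (\<lambda>n. F (X (n + N)) v) \<longlonglongrightarrow> f v"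
      by (intro AE_I2 LIMSEQ_ignore_initial_segment filterlim_compose[OF lim X])
  qed auto
qed

section \<open>Membership in the Fock space and the reproducing property for exponentials\<close>

lemma integral_fock_measure:
  fixes f :: "complex ^ 'n::finite \<Rightarrow> 'b::{banach, second_countable_topology}"
  assumes "lam > 0" "f \<in> borel_measurable borel"
  shows "integral\<^sup>L (fock_measure lam) f = ((lam / (2 * pi)) ^ CARD('n)) *\<^sub>R integral\<^sup>L lborel f"
  using assms unfolding fock_measure_def by (subst integral_density) auto

lemma integrable_fock_measure:
  fixes f :: "complex ^ 'n::finite \<Rightarrow> 'b::{banach, second_countable_topology}"
  assumes "lam > 0" "integrable lborel f"
  shows "integrable (fock_measure lam) f"
  using assms unfolding fock_measure_def by (subst integrable_density) auto

lemma sets_fock_measure [simp, measurable_cong]: "sets (fock_measure lam) = sets borel"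
  by (simp add: fock_measure_def)

lemma space_fock_measure [simp]: "space (fock_measure lam) = UNIV"
  by (simp add: fock_measure_def)

lemma integrable_exp_growth_fock:
  fixes f :: "complex ^ 'n::finite \<Rightarrow> 'b::{banach, second_countable_topology, real_normed_algebra_1}"
  assumes "exp_growth f" "lam > 0"
  shows "integrable (fock_measure lam) (\<lambda>v. f v * of_real (exp (- lam * (norm v)\<^sup>2 / 2)))"
  using integrable_fock_measure[OF assms(2) integrable_exp_growth_gaussian[OF assms(1), of "lam / 2"]] assms(2)
  by simp

lemma fock_space_exp_growth:
  assumes "exp_growth f" "holomorphic_vec f" "lam > 0"
  shows "f \<in> fock_space lam"
  using integrable_exp_growth_fock[OF exp_growth_mult[OF exp_growth_norm[OF assms(1)] exp_growth_norm[OF assms(1)]] assms(3)] assms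
  unfolding fock_space_def by (simp add: power2_eq_square)

lemma holomorphic_vec_affine_exp_bil: "holomorphic_vec (\<lambda>v. (a + bil p v) * exp (bil q v))"
  unfolding holomorphic_vec_def
proof
  fix z :: "complex ^ 'a"
  have lin: "(bil q has_derivative bil q) (at z)" for q
    by (rule bounded_linear_imp_has_derivative) (rule bounded_bilinear.bounded_linear_right[OF bounded_bilinear_bil])
  have "((\<lambda>v. (a + bil p v) * exp (bil q v)) has_derivative
      (\<lambda>v. (a + bil p z) * (exp (bil q z) * bil q v) + bil p v * exp (bil q z))) (at z)"
    using has_derivative_compose[OF lin[of q] DERIV_exp[THEN has_field_derivative_imp_has_derivative]]
    by (auto intro!: derivative_eq_intros lin)
  moreover have "bil q (c *s v) = c * bil q v" for q v :: "complex ^ 'a" and c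
    by (simp add: bil_def sum_distrib_left mult_ac)
  ultimately show "\<exists>D. ((\<lambda>v. (a + bil p v) * exp (bil q v)) has_derivative D) (at z) \<and> (\<forall>a v. D (a *s v) = a * D v)"
    by (intro exI conjI) (assumption, simp add: algebra_simps)
qed

lemma exp_growth_affine_exp_bil: "exp_growth (\<lambda>v. (a + bil p v) * exp (bil q v))"
  by (intro exp_growth_mult exp_growth_add exp_growth_const exp_growth_bil exp_growth_exp_bil)

lemma affine_exp_bil_in_fock_space: "lam > 0 \<Longrightarrow> (\<lambda>v. (a + bil p v) * exp (bil q v)) \<in> fock_space lam"
  by (intro fock_space_exp_growth exp_growth_affine_exp_bil holomorphic_vec_affine_exp_bil)

lemma bil_scaleR: "bil (r *\<^sub>R p) q = of_real r * bil p q"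
  by (simp add: bounded_bilinear.scaleR_left[OF bounded_bilinear_bil] scaleR_conv_of_real[where 'a=complex])

lemma coherent_eq: "coherent lam z = (\<lambda>v. exp (bil ((lam / 2) *\<^sub>R cnj_vec z) v))"
  by (simp add: coherent_def bil_scaleR fun_eq_iff)

lemma coherent_in_fock_space: "lam > 0 \<Longrightarrow> coherent lam w \<in> fock_space lam"
  using affine_exp_bil_in_fock_space[of lam 1 0] by (simp add: coherent_eq bounded_bilinear.zero_left[OF bounded_bilinear_bil])

lemma exp_growth_coherent: "exp_growth (coherent lam w)"
  by (simp add: coherent_eq exp_growth_exp_bil)

text \<open>The Gaussian integral with \<open>a = lam / 2\<close>, \<open>\<beta> = q\<close> and
  \<open>\<gamma> = (lam / 2) *\<^sub>R z\<close>: the quotient of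
  \<open>bil \<beta> \<gamma>\<close> by \<open>a\<close> is \<open>bil q z\<close>, and the
  constant density of \<open>fock_measure\<close> cancels the total mass.\<close>

lemma fock_inner_exp_bil_coherent:
  fixes q :: "complex ^ 'n::finite"
  assumes lam: "lam > 0"
  shows "fock_inner lam (\<lambda>v. exp (bil q v)) (coherent lam z) = exp (bil q z)"
proof -
  have "cnj (coherent lam z v) = exp (bil ((lam / 2) *\<^sub>R z) (cnj_vec v))" for v
    by (simp add: coherent_def exp_cnj bil_scaleR) (simp add: bil_def cnj_vec_def)
  then have *: "exp (bil q v) * cnj (coherent lam z v) * complex_of_real (exp (- lam * (norm v)\<^sup>2 / 2)) =
      exp (bil q v + bil ((lam / 2) *\<^sub>R z) (cnj_vec v)) * of_real (exp (- (lam / 2) * (norm v)\<^sup>2))" for v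
    by (simp add: exp_add)
  have b: "has_bochner_integral lborel
           (\<lambda>v. exp (bil q v + bil ((lam / 2) *\<^sub>R z) (cnj_vec v)) * of_real (exp (- (lam / 2) * (norm v)\<^sup>2)))
           (of_real ((pi / (lam / 2)) ^ CARD('n)) * exp (bil q ((lam / 2) *\<^sub>R z) / of_real (lam / 2)))"
    using lam by (intro has_bochner_integral_exp_bil_gaussian) simp
  have "fock_inner lam (\<lambda>v. exp (bil q v)) (coherent lam z) =
      (lam / (2 * pi)) ^ CARD('n) *\<^sub>R
        (of_real ((pi / (lam / 2)) ^ CARD('n)) * exp (bil q ((lam / 2) *\<^sub>R z) / of_real (lam / 2)))"
    unfolding fock_inner_def *
    by (subst integral_fock_measure[OF lam]) (use b in \<open>auto simp: has_bochner_integral_iff intro: borel_measurable_integrable\<close>)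
  also have "\<dots> = exp (bil q z)"
  proof -
    have "(lam / (2 * pi)) ^ CARD('n) * (pi / (lam / 2)) ^ CARD('n) = 1"
      using lam by (simp add: power_mult_distrib[symmetric])
    then have "complex_of_real ((lam / (2 * pi)) ^ CARD('n)) * of_real ((pi / (lam / 2)) ^ CARD('n)) = 1"
      by (simp only: of_real_mult[symmetric] of_real_1)
    moreover have "bil q ((lam / 2) *\<^sub>R z) / of_real (lam / 2) = bil q z"
      using lam by (simp add: bounded_bilinear.scaleR_right[OF bounded_bilinear_bil] scaleR_conv_of_real[where 'a=complex])
    ultimately show ?thesis by (simp add: scaleR_conv_of_real mult.assoc[symmetric])
  qed
  finally show ?thesis .
qed

section \<open>Differentiating a curve of exponentials in the Fock norm and inside an inner
  product\<close>

context
  fixes \<kappa> :: "real \<Rightarrow> complex" and q :: "real \<Rightarrow> complex ^ 'n::finite" and lam :: real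
    and \<kappa>' :: complex and q' :: "complex ^ 'n"
  assumes \<kappa>: "(\<kappa> has_vector_derivative \<kappa>') (at 0)" and q: "(q has_vector_derivative q') (at 0)"
    and lam: "lam > 0"
begin

private definition D :: "real \<Rightarrow> complex ^ 'n \<Rightarrow> complex" where
  "D s v = (\<kappa> s * exp (bil (q s) v) - \<kappa> 0 * exp (bil (q 0) v)) / of_real s
                  - (\<kappa>' + \<kappa> 0 * bil q' v) * exp (bil (q 0) v)"

text \<open>Division becomes multiplication by a constant, to which the closure rules of
  \<open>exp_growth\<close> apply. At \<open>s = 0\<close> both forms agree because division by 0
  yields 0.\<close>

private lemma D_eq: "D s = (\<lambda>v. (\<kappa> s * exp (bil (q s) v) - \<kappa> 0 * exp (bil (q 0) v)) * (1 / of_real s)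
                  - (\<kappa>' + \<kappa> 0 * bil q' v) * exp (bil (q 0) v))"
  by (simp add: D_def fun_eq_iff)

private lemma growth_D: "exp_growth (D s)"
  unfolding D_eq
  by (intro exp_growth_diff exp_growth_mult exp_growth_add exp_growth_const exp_growth_exp_bil exp_growth_bil)

private lemma measurable_D [measurable]: "D s \<in> borel_measurable borel"
  by (rule exp_growth_measurable[OF growth_D])

private lemma measurable_cnj_D [measurable]: "(\<lambda>v. cnj (D s v)) \<in> borel_measurable borel"
  by (rule exp_growth_measurable[OF exp_growth_cnj[OF growth_D]])

text \<open>The majorant \<open>w\<close> of \<open>D s\<close> yields the majorant
  \<open>w v * w v\<close>, times the weight, for the integrand of the squared norm.\<close>

lemma fock_norm_difference_quotient:
  "((\<lambda>s. fock_norm lam (\<lambda>v. (\<kappa> s * exp (bil (q s) v) - \<kappa> 0 * exp (bil (q 0) v)) / of_real s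
            - (\<kappa>' + \<kappa> 0 * bil q' v) * exp (bil (q 0) v))) \<longlongrightarrow> 0) (at 0)"
proof -
  obtain w where w: "exp_growth w" "\<forall>\<^sub>F s in at 0. \<forall>v. norm (D s v) \<le> w v"
    using exp_bil_difference_quotient_bound[OF \<kappa> q] unfolding D_def by blast
  have "((\<lambda>s. \<integral>v. D s v * cnj (D s v) * of_real (exp (- lam * (norm v)\<^sup>2 / 2)) \<partial>fock_measure lam)
      \<longlongrightarrow> (\<integral>v. 0 \<partial>(fock_measure lam :: (complex ^ 'n) measure))) (at 0)"
  proof (rule integral_dominated_convergence_at)
    show "integrable (fock_measure lam) (\<lambda>v. (w v * w v) * of_real (exp (- lam * (norm v)\<^sup>2 / 2)))"
      by (intro integrable_exp_growth_fock exp_growth_mult w lam)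
    show "\<forall>\<^sub>F s in at 0. \<forall>v. norm (D s v * cnj (D s v) * of_real (exp (- lam * (norm v)\<^sup>2 / 2)))
        \<le> (w v * w v) * of_real (exp (- lam * (norm v)\<^sup>2 / 2))"
      using w(2)
    proof eventually_elim
      case (elim s)
      then have "cmod (D s v) * cmod (D s v) \<le> w v * w v" for v
        by (intro mult_mono) (auto intro: order.trans[OF norm_ge_zero])
      then show ?case by (auto simp: norm_mult intro: mult_right_mono)
    qed
    show "((\<lambda>s. D s v * cnj (D s v) * of_real (exp (- lam * (norm v)\<^sup>2 / 2))) \<longlongrightarrow> 0) (at 0)" for v
      using exp_bil_difference_quotient_tendsto[OF \<kappa> q, of v] unfolding D_def[symmetric]
      by (auto intro!: tendsto_eq_intros)
  qed auto
  then have "((\<lambda>s. fock_norm lam (D s)) \<longlongrightarrow> sqrt (Re 0)) (at 0)"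
    unfolding fock_norm_def fock_inner_def by (intro tendsto_intros) simp
  then show ?thesis by (simp add: D_def[abs_def])
qed

text \<open>The linear factor is handled by differentiating \<open>fock_inner_exp_bil_coherent\<close> under the integral.\<close>

lemma fock_inner_affine_exp_bil_coherent_aux:
  "fock_inner lam (\<lambda>v. (\<kappa>' + \<kappa> 0 * bil q' v) * exp (bil (q 0) v)) (coherent lam z) =
     (\<kappa>' + \<kappa> 0 * bil q' z) * exp (bil (q 0) z)"
proof -
  let ?h = "\<lambda>v. (\<kappa>' + \<kappa> 0 * bil q' v) * exp (bil (q 0) v)"
  obtain w where w: "exp_growth w" "\<forall>\<^sub>F s in at 0. \<forall>v. norm (D s v) \<le> w v"
    using exp_bil_difference_quotient_bound[OF \<kappa> q] unfolding D_def by blast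
  have [measurable]: "(\<lambda>v. cnj (coherent lam z v)) \<in> borel_measurable borel"
    by (rule exp_growth_measurable[OF exp_growth_cnj[OF exp_growth_coherent]])
  have "((\<lambda>s. fock_inner lam (D s) (coherent lam z))
      \<longlongrightarrow> (\<integral>v. 0 \<partial>(fock_measure lam :: (complex ^ 'n) measure))) (at 0)"
    unfolding fock_inner_def
  proof (rule integral_dominated_convergence_at)
    show "integrable (fock_measure lam) (\<lambda>v. (w v * cmod (coherent lam z v)) * of_real (exp (- lam * (norm v)\<^sup>2 / 2)))"
      by (intro integrable_exp_growth_fock exp_growth_mult exp_growth_norm exp_growth_coherent w lam)
    show "\<forall>\<^sub>F s in at 0. \<forall>v. norm (D s v * cnj (coherent lam z v) * of_real (exp (- lam * (norm v)\<^sup>2 / 2)))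
        \<le> (w v * cmod (coherent lam z v)) * of_real (exp (- lam * (norm v)\<^sup>2 / 2))"
      using w(2) by eventually_elim (auto simp: norm_mult intro!: mult_right_mono)
    show "((\<lambda>s. D s v * cnj (coherent lam z v) * of_real (exp (- lam * (norm v)\<^sup>2 / 2))) \<longlongrightarrow> 0) (at 0)" for v
      using exp_bil_difference_quotient_tendsto[OF \<kappa> q, of v] unfolding D_def[symmetric]
      by (auto intro!: tendsto_eq_intros)
  qed auto
  \<comment> \<open>The inner products of the pure exponentials in \<open>D s\<close> are known, so
    the only unknown is that of \<open>?h\<close>. The left side and \<open>D s z\<close> both tend
    to 0, which forces the unknown to equal \<open>?h z\<close>.\<close>
  moreover have "fock_inner lam (D s) (coherent lam z) = D s z + ?h z - fock_inner lam ?h (coherent lam z)" for s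
  proof -
    have int: "has_bochner_integral (fock_measure lam)
        (\<lambda>v. f v * cnj (coherent lam z v) * of_real (exp (- lam * (norm v)\<^sup>2 / 2)))
        (fock_inner lam f (coherent lam z))"
      if "exp_growth f" for f
      unfolding has_bochner_integral_iff fock_inner_def
      by (intro conjI refl integrable_exp_growth_fock exp_growth_mult exp_growth_cnj exp_growth_coherent that lam)
    have "fock_inner lam (D s) (coherent lam z) =
      (\<kappa> s * fock_inner lam (\<lambda>v. exp (bil (q s) v)) (coherent lam z)
        - \<kappa> 0 * fock_inner lam (\<lambda>v. exp (bil (q 0) v)) (coherent lam z)) / of_real s
       - fock_inner lam ?h (coherent lam z)"
    proof -
      let ?G = "\<lambda>v. (\<kappa> s * (exp (bil (q s) v) * cnj (coherent lam z v) * of_real (exp (- lam * (norm v)\<^sup>2 / 2))) -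
         \<kappa> 0 * (exp (bil (q 0) v) * cnj (coherent lam z v) * of_real (exp (- lam * (norm v)\<^sup>2 / 2)))) / of_real s -
        ?h v * cnj (coherent lam z v) * of_real (exp (- lam * (norm v)\<^sup>2 / 2))"
      have "D s v * cnj (coherent lam z v) * of_real (exp (- lam * (norm v)\<^sup>2 / 2)) = ?G v" for v
      proof -
        have "((a * x - b * y) / c - d) * g * e = (a * (x * g * e) - b * (y * g * e)) / c - d * g * e"
          for a b c d e g x y :: complex
          by (simp add: divide_inverse algebra_simps)
        then show ?thesis unfolding D_def .
      qed
      then have "fock_inner lam (D s) (coherent lam z) = (\<integral>v. ?G v \<partial>fock_measure lam)"
        by (simp only: fock_inner_def)
      also have "\<dots> = (\<kappa> s * fock_inner lam (\<lambda>v. exp (bil (q s) v)) (coherent lam z)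
          - \<kappa> 0 * fock_inner lam (\<lambda>v. exp (bil (q 0) v)) (coherent lam z)) / of_real s
         - fock_inner lam ?h (coherent lam z)"
        by (intro has_bochner_integral_integral_eq has_bochner_integral_diff has_bochner_integral_divide_zero
            has_bochner_integral_mult_right int exp_growth_affine_exp_bil exp_growth_exp_bil
            exp_growth_mult exp_growth_add exp_growth_const exp_growth_bil)
      finally show ?thesis .
    qed
    then show ?thesis unfolding fock_inner_exp_bil_coherent[OF lam] by (simp add: D_def)
  qed
  ultimately have "((\<lambda>s. D s z + ?h z - fock_inner lam ?h (coherent lam z)) \<longlongrightarrow> 0) (at 0)"
    by simp
  moreover have "((\<lambda>s. D s z + ?h z - fock_inner lam ?h (coherent lam z)) \<longlongrightarrow> 0 + ?h z - fock_inner lam ?h (coherent lam z)) (at 0)"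
    using exp_bil_difference_quotient_tendsto[OF \<kappa> q, of z] unfolding D_def[symmetric]
    by (intro tendsto_intros)
  ultimately have "0 + ?h z - fock_inner lam ?h (coherent lam z) = 0"
    by (rule tendsto_unique[OF trivial_limit_at, rotated])
  then show ?thesis by simp
qed

end

lemma fock_inner_affine_exp_bil_coherent:
  assumes "lam > 0"
  shows "fock_inner lam (\<lambda>v. (a + bil p v) * exp (bil q v)) (coherent lam z) = (a + bil p z) * exp (bil q z)"
proof -
  \<comment> \<open>\<open>(a + bil p v) * exp (bil q v)\<close> is the derivative at 0 of
    \<open>(1 + s * a) * exp (bil (q + s *\<^sub>R p) v)\<close>.\<close>
  have "((\<lambda>s. 1 + of_real s * a) has_vector_derivative a) (at 0)"
    by (auto intro!: derivative_eq_intros simp: has_vector_derivative_def scaleR_conv_of_real)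
  moreover have "((\<lambda>s. q + s *\<^sub>R p) has_vector_derivative p) (at 0)"
    by (auto intro!: derivative_eq_intros simp: has_vector_derivative_def)
  ultimately show ?thesis
    using fock_inner_affine_exp_bil_coherent_aux[of "\<lambda>s. 1 + of_real s * a" a "\<lambda>s. q + s *\<^sub>R p" p lam z] assms
    by simp
qed

subsection \<open>One-parameter subgroups and characters\<close>

text \<open>Integrating the functional equation gains regularity: with an antiderivative
  \<open>F\<close>, the function \<open>f\<close> becomes a difference of translates of
  \<open>F\<close> divided by a constant.\<close>

lemma exponential_has_vector_derivative:
  fixes f :: "real \<Rightarrow> complex"
  assumes cont: "continuous_on UNIV f" and add: "\<And>r s. f (r + s) = f r * f s" and f0: "f 0 = 1"
  shows "\<exists>d. (f has_vector_derivative d) (at 0)"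
proof -
  have "isCont f x" for x using cont by (simp add: continuous_on_eq_continuous_at)
  then obtain F where F: "\<And>x. (F has_vector_derivative f x) (at x)"
    using einterval_antiderivative[of "-\<infinity>" "\<infinity>" f] by auto
  \<comment> \<open>The derivative of \<open>F\<close> at 0 is 1, which provides some
    \<open>\<delta>\<close> with a nonzero increment to divide by.\<close>
  have "((\<lambda>s. (F s - F 0) /\<^sub>R s) \<longlongrightarrow> 1) (at 0)"
    using has_vector_derivative_difference_quotient[OF F[of 0]] f0 by simp
  then have "\<forall>\<^sub>F s in at 0. (F s - F 0) /\<^sub>R s \<noteq> 0"
    by (rule tendsto_imp_eventually_ne) simp
  then obtain \<delta> where \<delta>: "F \<delta> - F 0 \<noteq> 0"
    using eventually_happens'[OF trivial_limit_at, of _ "0::real"] by fastforce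
  have f_eq: "f x = (F (x + \<delta>) - F x) / (F \<delta> - F 0)" for x
  proof -
    \<comment> \<open>Both terms have the derivative \<open>f (x + y) = f x * f y\<close> in
      \<open>y\<close>.\<close>
    have "((\<lambda>y. F (x + y) - f x * F y) has_vector_derivative 0) (at y within UNIV)" for y
    proof -
      have "((\<lambda>y. x + y) has_vector_derivative 1) (at y)" by (auto intro!: derivative_eq_intros)
      from has_vector_derivative_diff[OF vector_diff_chain_at[OF this F] has_vector_derivative_mult_right[OF F[of y], of "f x"]]
      show ?thesis by (simp add: o_def add)
    qed
    then obtain c where "\<And>y. F (x + y) - f x * F y = c"
      using has_vector_derivative_zero_constant[of UNIV "\<lambda>y. F (x + y) - f x * F y"] by auto
    from this[of \<delta>] this[of 0] have "F (x + \<delta>) - F x = f x * (F \<delta> - F 0)" by (simp add: algebra_simps)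
    with \<delta> show ?thesis by simp
  qed
  have "((\<lambda>x. F (x + \<delta>)) has_vector_derivative f \<delta>) (at 0)"
  proof -
    have "((\<lambda>x. x + \<delta>) has_vector_derivative 1) (at 0)" by (auto intro!: derivative_eq_intros)
    from vector_diff_chain_at[OF this F] show ?thesis by (simp add: o_def)
  qed
  then have "((\<lambda>x. (F (x + \<delta>) - F x) * (1 / (F \<delta> - F 0))) has_vector_derivative (f \<delta> - f 0) * (1 / (F \<delta> - F 0))) (at 0)"
    by (intro has_vector_derivative_mult_left has_vector_derivative_diff F)
  moreover have "(\<lambda>x. (F (x + \<delta>) - F x) * (1 / (F \<delta> - F 0))) = f"
    by (rule ext) (simp only: f_eq times_divide_eq_right mult_1_right)
  ultimately show ?thesis by auto
qed

lemma unitary_character_zero: "unitary_character chi \<Longrightarrow> chi 0 = 1"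
proof -
  assume "unitary_character chi"
  then have "chi (0 + 0) = chi 0 * chi 0" "norm (chi 0) = 1" unfolding unitary_character_def by blast+
  then show ?thesis by (metis add_0 mult_cancel_left1 norm_zero zero_neq_one)
qed

text \<open>A character is the product over \<open>Basis\<close> of its restrictions to the
  coordinate lines, each a continuous homomorphism from the additive reals. This makes
  \<open>frechet_derivative chi (at 0)\<close> the genuine differential.\<close>

lemma unitary_character_differentiable:
  assumes chi: "unitary_character chi"
  shows "chi differentiable (at 0)"
proof -
  have add: "chi (s + t) = chi s * chi t" and cont: "continuous_on UNIV chi" for s t
    using chi by (auto simp: unitary_character_def)
  have 1: "(\<lambda>x. chi ((x \<bullet> b) *\<^sub>R b)) differentiable (at 0)" for b
  proof -
    have "\<exists>d. ((\<lambda>r. chi (r *\<^sub>R b)) has_vector_derivative d) (at 0)"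
      by (intro exponential_has_vector_derivative)
        (auto simp: add scaleR_add_left unitary_character_zero[OF chi]
          intro!: continuous_on_compose2[OF cont] continuous_intros)
    then have "(\<lambda>r. chi (r *\<^sub>R b)) differentiable (at ((0 :: real ^ 'a) \<bullet> b))"
      by (auto intro: differentiableI_vector)
    moreover have "(\<lambda>x. x \<bullet> b) differentiable (at (0 :: real ^ 'a))"
      by (rule bounded_linear_imp_differentiable) (rule bounded_linear_inner_left)
    ultimately show ?thesis using differentiable_chain_at by (fastforce simp: o_def)
  qed
  have "(\<lambda>x. chi (\<Sum>b\<in>B. (x \<bullet> b) *\<^sub>R b)) differentiable (at 0)" if "finite B" for B
    using that by induction (auto simp: add 1 intro!: differentiable_mult)
  from this[of Basis] show ?thesis by (simp add: euclidean_representation)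
qed

section \<open>Calculus in the group coordinates and uniqueness of one-parameter subgroups\<close>

lemma has_vector_derivative_vec:
  fixes f :: "'n::finite \<Rightarrow> real \<Rightarrow> complex"
  assumes "\<And>k. (f k has_vector_derivative f' k) (at x)"
  shows "((\<lambda>r. \<chi> k. f k r) has_vector_derivative (\<chi> k. f' k)) (at x)"
proof -
  have eq: "(\<chi> k. g k) = (\<Sum>k\<in>UNIV. axis k (g k))" for g :: "'n \<Rightarrow> complex"
    by (simp add: vec_eq_iff axis_def)
  have axis: "bounded_linear (axis k :: complex \<Rightarrow> complex ^ 'n)" for k
    by (intro linearI linear_linear[THEN iffD2]) (auto simp: vec_eq_iff axis_def)
  show ?thesis
    unfolding eq by (intro has_vector_derivative_sum bounded_linear.has_vector_derivative[OF axis] assms)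
qed

lemma torus_act_zero: "(\<And>k. linear (alpha k)) \<Longrightarrow> torus_act alpha 0 z = z"
  by (simp add: torus_act_def linear_0)

lemma bounded_linear_torus_act: "bounded_linear (torus_act alpha t)"
  by (intro linearI linear_linear[THEN iffD2]) (auto simp: torus_act_def vec_eq_iff algebra_simps)

lemma bounded_linear_cnj_vec: "bounded_linear cnj_vec"
  by (intro linearI linear_linear[THEN iffD2]) (auto simp: cnj_vec_def vec_eq_iff)

lemma Re_omega_cnj_vec: "Re (omega (z, cnj_vec z) (w, cnj_vec w)) = - Im (bil z (cnj_vec w))"
proof -
  have "bil w (cnj_vec z) = cnj (bil z (cnj_vec w))" by (simp add: bil_def cnj_vec_def mult.commute)
  then show ?thesis by (simp add: omega_def)
qed

lemma bounded_linear_omega_right: "bounded_linear (\<lambda>w. Re (omega (z, cnj_vec z) (w, cnj_vec w)))"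
  unfolding Re_omega_cnj_vec
  by (intro bounded_linear_minus bounded_linear_compose[OF bounded_linear_Im]
      bounded_linear_compose[OF bounded_bilinear.bounded_linear_right[OF bounded_bilinear_bil] bounded_linear_cnj_vec])

text \<open>In each coordinate the group law has this form, with \<open>B\<close> depending on the
  fixed \<open>r\<close>; thus the velocity at 0 determines the velocity everywhere.\<close>

lemma has_vector_derivative_shift_orbit:
  fixes f :: "real \<Rightarrow> 'a::real_normed_vector"
  assumes "\<And>s. f (r + s) = f r + B s" "(B has_vector_derivative b) (at 0)"
  shows "(f has_vector_derivative b) (at r)"
proof -
  have "((\<lambda>x. x - r) has_vector_derivative 1) (at r)" by (auto intro!: derivative_eq_intros)
  from vector_diff_chain_at[OF this, of B b] assms(2)
  have "((\<lambda>x. f r + B (x - r)) has_vector_derivative b) (at r)"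
    by (auto intro!: derivative_eq_intros simp: o_def)
  moreover have "f x = f r + B (x - r)" for x using assms(1)[of "x - r"] by simp
  ultimately show ?thesis by (metis (no_types, lifting) ext)
qed

lemma has_vector_derivative_unique_function:
  fixes f g :: "real \<Rightarrow> 'a::real_normed_vector"
  assumes "\<And>r. (f has_vector_derivative f' r) (at r)" "\<And>r. (g has_vector_derivative f' r) (at r)" "f 0 = g 0"
  shows "f = g"
proof -
  have "((\<lambda>x. f x - g x) has_vector_derivative 0) (at x within UNIV)" for x
    using has_vector_derivative_diff[OF assms(1,2)] by simp
  then obtain c where c: "\<And>x. f x - g x = c"
    using has_vector_derivative_zero_constant[of UNIV "\<lambda>x. f x - g x"] by auto
  from c[of 0] assms(3) have "c = 0" by simp
  with c show ?thesis by auto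
qed

lemma one_parameter_subgroup_components:
  assumes lin: "\<And>k. linear (alpha k)" and g: "one_parameter_subgroup alpha (t, u, c) g"
  shows "fst (g 0) = 0" "fst (snd (g 0)) = 0" "snd (snd (g 0)) = 0"
    and "((\<lambda>r. fst (g r)) has_vector_derivative t) (at r)"
    and "((\<lambda>r. fst (snd (g r))) has_vector_derivative torus_act alpha (fst (g r)) u) (at r)"
    and "((\<lambda>r. snd (snd (g r))) has_vector_derivative
           c + 1 / 2 * Re (omega (fst (snd (g r)), cnj_vec (fst (snd (g r))))
               (torus_act alpha (fst (g r)) u, cnj_vec (torus_act alpha (fst (g r)) u)))) (at r)"
proof -
  define T Z C where "T = (\<lambda>r. fst (g r))" and "Z = (\<lambda>r. fst (snd (g r)))" and "C = (\<lambda>r. snd (snd (g r)))"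
  have g_eq: "g r = (T r, Z r, C r)" for r by (simp add: T_def Z_def C_def)
  have "g (r + s) = diamond_mult alpha (g r) (g s)" for r s
    using g by (simp add: one_parameter_subgroup_def)
  then have add: "T (r + s) = T r + T s" "Z (r + s) = Z r + torus_act alpha (T r) (Z s)"
    "C (r + s) = C r + (C s + 1 / 2 * Re (omega (Z r, cnj_vec (Z r))
        (torus_act alpha (T r) (Z s), cnj_vec (torus_act alpha (T r) (Z s)))))" for r s
    unfolding g_eq by auto
  have T0: "T 0 = 0" using add(1)[of 0 0] by simp
  have Z0: "Z 0 = 0" using add(2)[of 0 0] by (simp add: T0 torus_act_zero lin)
  have "omega (0, p) (0, p') = 0" for p p' :: "complex ^ 'a"
    by (simp add: omega_def bounded_bilinear.zero_left[OF bounded_bilinear_bil])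
  moreover have "torus_act alpha (T 0) (Z 0) = 0" by (simp add: T0 Z0 torus_act_zero lin)
  ultimately have C0: "C 0 = 0" using add(3)[of 0 0] unfolding Z0 by simp
  have gd: "(g has_vector_derivative (t, u, c)) (at 0)"
    using g by (simp add: one_parameter_subgroup_def)
  note snd_gd = bounded_linear.has_vector_derivative[OF bounded_linear_snd gd]
  have T': "(T has_vector_derivative t) (at 0)"
    using bounded_linear.has_vector_derivative[OF bounded_linear_fst gd] by (simp add: T_def)
  have Z': "(Z has_vector_derivative u) (at 0)"
    using bounded_linear.has_vector_derivative[OF bounded_linear_fst snd_gd] by (simp add: Z_def)
  have C': "(C has_vector_derivative c) (at 0)"
    using bounded_linear.has_vector_derivative[OF bounded_linear_snd snd_gd] by (simp add: C_def)
  show "fst (g 0) = 0" "fst (snd (g 0)) = 0" "snd (snd (g 0)) = 0"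
    using T0 Z0 C0 by (auto simp: T_def Z_def C_def)
  have "(T has_vector_derivative t) (at r)"
    by (rule has_vector_derivative_shift_orbit[where f = T and r = r, OF add(1)[of r] T'])
  then show "((\<lambda>r. fst (g r)) has_vector_derivative t) (at r)" by (simp add: T_def)
  note actZ = bounded_linear.has_vector_derivative[OF bounded_linear_torus_act Z']
  have "(Z has_vector_derivative torus_act alpha (T r) u) (at r)"
    by (rule has_vector_derivative_shift_orbit[where f = Z and r = r, OF add(2)[of r] actZ])
  then show "((\<lambda>r. fst (snd (g r))) has_vector_derivative torus_act alpha (fst (g r)) u) (at r)"
    by (simp add: Z_def T_def)
  have "(C has_vector_derivative c + 1 / 2 * Re (omega (Z r, cnj_vec (Z r))
        (torus_act alpha (T r) u, cnj_vec (torus_act alpha (T r) u)))) (at r)"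
    by (rule has_vector_derivative_shift_orbit[where f = C and r = r, OF add(3)[of r]])
      (intro has_vector_derivative_add has_vector_derivative_mult_right C'
        bounded_linear.has_vector_derivative[OF bounded_linear_omega_right actZ])
  then show "((\<lambda>r. snd (snd (g r))) has_vector_derivative
           c + 1 / 2 * Re (omega (fst (snd (g r)), cnj_vec (fst (snd (g r))))
               (torus_act alpha (fst (g r)) u, cnj_vec (torus_act alpha (fst (g r)) u)))) (at r)"
    by (simp add: C_def Z_def T_def)
qed

text \<open>The derivative of the first coordinate is constant, that of the second involves only the
  first, that of the third only the first two. Equality therefore propagates from coordinate to
  coordinate by plain integration.\<close>

lemma one_parameter_subgroup_unique:
  assumes lin: "\<And>k. linear (alpha k)"
    and g: "one_parameter_subgroup alpha X g" and h: "one_parameter_subgroup alpha X h"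
  shows "g = h"
proof -
  obtain t u c where X: "X = (t, u, c)" by (cases X)
  note G = one_parameter_subgroup_components[OF lin g[unfolded X]]
    and H = one_parameter_subgroup_components[OF lin h[unfolded X]]
  have T: "(\<lambda>r. fst (g r)) = (\<lambda>r. fst (h r))"
    by (rule has_vector_derivative_unique_function[OF G(4) H(4)]) (simp add: G H)
  have Z: "(\<lambda>r. fst (snd (g r))) = (\<lambda>r. fst (snd (h r)))"
    by (rule has_vector_derivative_unique_function[OF G(5)])
      (use H(5) fun_cong[OF T] in \<open>simp_all add: G(2) H(2)\<close>)
  have C: "(\<lambda>r. snd (snd (g r))) = (\<lambda>r. snd (snd (h r)))"
    by (rule has_vector_derivative_unique_function[OF G(6)])
      (use H(6) fun_cong[OF T] fun_cong[OF Z] in \<open>simp_all add: G(3) H(3)\<close>)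
  show ?thesis
    using fun_cong[OF T] fun_cong[OF Z] fun_cong[OF C] by (auto simp: fun_eq_iff prod_eq_iff)
qed

text \<open>The integral of \<open>exp (i a s)\<close> over \<open>[0, r]\<close>.\<close>

definition circle_int :: "real \<Rightarrow> real \<Rightarrow> complex" where
  "circle_int a r = (if a = 0 then of_real r else (exp (\<i> * of_real (a * r)) - 1) / (\<i> * of_real a))"

text \<open>The cocycle identity demanded by the semidirect product: the second part of the path is
  rotated by the angle already reached.\<close>

lemma circle_int_add: "circle_int a (r + s) = circle_int a r + exp (\<i> * of_real (a * r)) * circle_int a s"
proof (cases "a = 0")
  case False
  have "exp (\<i> * of_real (a * (r + s))) = exp (\<i> * of_real (a * r)) * exp (\<i> * of_real (a * s))"
    by (simp add: exp_add[symmetric] algebra_simps)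
  with False show ?thesis by (simp add: circle_int_def field_simps)
qed (simp add: circle_int_def)

text \<open>
  \<open>(a r - sin (a r)) / a\<^sup>2\<close> is twice the area swept by \<open>circle_int a\<close>, the central coordinate
  of the one-parameter subgroup. For \<open>a = 0\<close> the area is 0, in agreement with \<open>x / 0 = 0\<close>.
\<close>

lemma circle_int_area_add:
  "(a * (r + s) - sin (a * (r + s))) / a\<^sup>2 = (a * r - sin (a * r)) / a\<^sup>2 + (a * s - sin (a * s)) / a\<^sup>2
     - Im (circle_int a r * cnj (exp (\<i> * of_real (a * r)) * circle_int a s))"
proof (cases "a = 0")
  case False
  have *: "Im (circle_int a r * cnj (exp (\<i> * of_real (a * r)) * circle_int a s)) =
      (sin (a * r + a * s) - sin (a * r) - sin (a * s)) / a\<^sup>2"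
  proof -
    have h: "sin (a * s) = cos (a * r) * (cos (a * r) * sin (a * s)) + sin (a * r) * (sin (a * r) * sin (a * s))"
      using sin_cos_squared_add[of "a * r"] by algebra
    \<comment> \<open>With real denominators \<open>Im\<close> commutes with the division, and the
      factor \<open>- \<i>\<close> cancels against its conjugate.\<close>
    have "circle_int a r = (exp (\<i> * of_real (a * r)) - 1) * (- \<i>) / of_real a"
      and "circle_int a s = (exp (\<i> * of_real (a * s)) - 1) * (- \<i>) / of_real a"
      using False by (simp_all add: circle_int_def field_simps)
    then have "Im (circle_int a r * cnj (exp (\<i> * of_real (a * r)) * circle_int a s)) =
        Im ((exp (\<i> * of_real (a * r)) - 1) * cnj (exp (\<i> * of_real (a * r)) * (exp (\<i> * of_real (a * s)) - 1)) / of_real (a * a))"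
      by (simp add: field_simps)
    also have "\<dots> = Im ((exp (\<i> * of_real (a * r)) - 1) * cnj (exp (\<i> * of_real (a * r)) * (exp (\<i> * of_real (a * s)) - 1))) / (a * a)"
      by (rule Im_divide_of_real)
    also have "Im ((exp (\<i> * of_real (a * r)) - 1) * cnj (exp (\<i> * of_real (a * r)) * (exp (\<i> * of_real (a * s)) - 1))) =
        sin (a * r + a * s) - sin (a * r) - sin (a * s)"
      unfolding cis_conv_exp[symmetric] by (simp add: sin_add power2_eq_square algebra_simps) (rule h)
    finally show ?thesis by (simp add: power2_eq_square algebra_simps)
  qed
  show ?thesis unfolding * by (simp add: distrib_left add_divide_distrib diff_divide_distrib)
qed (simp add: circle_int_def)

lemma circle_int_has_vector_derivative: "(circle_int a has_vector_derivative 1) (at 0)"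
proof (cases "a = 0")
  case True
  have "((\<lambda>r. complex_of_real r) has_vector_derivative complex_of_real 1) (at 0)"
    by (intro has_vector_derivative_of_real) (auto intro!: derivative_eq_intros)
  then show ?thesis using True by (simp add: circle_int_def[abs_def])
next
  case False
  define d where "d = \<i> * complex_of_real a"
  have d: "d \<noteq> 0" using False by (simp add: d_def)
  have "((\<lambda>r. exp (r *\<^sub>R d)) has_vector_derivative d * exp (0 *\<^sub>R d)) (at 0)"
    by (rule exp_scaleR_has_vector_derivative_left)
  from has_vector_derivative_mult_left[OF has_vector_derivative_diff[OF this has_vector_derivative_const[of 1]], of "1 / d"]
  have "((\<lambda>r. (exp (r *\<^sub>R d) - 1) * (1 / d)) has_vector_derivative 1) (at 0)"
    using d by simp
  moreover have "circle_int a = (\<lambda>r. (exp (r *\<^sub>R d) - 1) * (1 / d))"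
    using False by (intro ext) (simp add: circle_int_def d_def scaleR_conv_of_real mult_ac)
  ultimately show ?thesis by simp
qed

text \<open>The swept area vanishes to higher order at 0, so it leaves the central velocity
  \<open>c\<close> unchanged.\<close>

lemma circle_int_area_has_vector_derivative:
  "((\<lambda>r. (a * r - sin (a * r)) / a\<^sup>2) has_vector_derivative 0) (at 0)"
proof -
  have "((\<lambda>r. a * r - sin (a * r)) has_field_derivative a - cos (a * 0) * a) (at 0)"
    by (auto intro!: derivative_eq_intros)
  from DERIV_cdivide[OF this, of "a\<^sup>2"]
  show ?thesis by (simp add: has_real_derivative_iff_has_vector_derivative)
qed

lemma one_parameter_subgroup_exists:
  assumes lin: "\<And>k. linear (alpha k)"
  shows "\<exists>g. one_parameter_subgroup alpha (t, u, c) g"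
proof -
  define a where "a k = alpha k t" for k
  \<comment> \<open>\<open>Z r\<close> is the integral of
    \<open>torus_act alpha (s *\<^sub>R t) u\<close> over \<open>s\<close> from 0 to
    \<open>r\<close>. \<open>S\<close> weights the doubled areas by the squared moduli of the
    components of \<open>u\<close>; half of it is what \<open>omega\<close> accumulates along the
    curve.\<close>
  define Z where "Z r = (\<chi> k. circle_int (a k) r * u $ k)" for r
  define S where "S r = (\<Sum>k\<in>UNIV. (cmod (u $ k))\<^sup>2 * ((a k * r - sin (a k * r)) / (a k)\<^sup>2))" for r
  define C where "C r = r * c + 1 / 2 * S r" for r
  have act: "torus_act alpha (r *\<^sub>R t) v = (\<chi> k. exp (\<i> * of_real (a k * r)) * v $ k)" for r v
    by (simp add: torus_act_def a_def linear_scale[OF lin] mult.commute)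
  have Z_add: "Z (r + s) = Z r + torus_act alpha (r *\<^sub>R t) (Z s)" for r s
    by (simp add: act Z_def vec_eq_iff circle_int_add algebra_simps)
  have S_add: "S (r + s) = S r + S s - Im (bil (Z r) (cnj_vec (torus_act alpha (r *\<^sub>R t) (Z s))))" for r s
  proof -
    have "bil (Z r) (cnj_vec (torus_act alpha (r *\<^sub>R t) (Z s))) =
      (\<Sum>k\<in>UNIV. of_real ((cmod (u $ k))\<^sup>2) * (circle_int (a k) r * cnj (exp (\<i> * of_real (a k * r)) * circle_int (a k) s)))"
      unfolding bil_def act cnj_vec_def Z_def
      by (intro sum.cong refl) (unfold complex_norm_square, simp add: mult_ac)
    then have "Im (bil (Z r) (cnj_vec (torus_act alpha (r *\<^sub>R t) (Z s)))) =
      (\<Sum>k\<in>UNIV. (cmod (u $ k))\<^sup>2 * Im (circle_int (a k) r * cnj (exp (\<i> * of_real (a k * r)) * circle_int (a k) s)))"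
      by (simp only: Im_sum) (simp only: Im_complex_of_real Re_complex_of_real times_complex.sel mult_zero_left add_0_right)
    then show ?thesis
      unfolding S_def circle_int_area_add by (simp only: distrib_left right_diff_distrib sum.distrib sum_subtractf)
  qed
  have "one_parameter_subgroup alpha (t, u, c) (\<lambda>r. (r *\<^sub>R t, Z r, C r))"
    unfolding one_parameter_subgroup_def
  proof (intro conjI allI)
    show "((r + s) *\<^sub>R t, Z (r + s), C (r + s)) = diamond_mult alpha (r *\<^sub>R t, Z r, C r) (s *\<^sub>R t, Z s, C s)" for r s
      by (simp add: scaleR_add_left Z_add Re_omega_cnj_vec C_def S_add algebra_simps)
    have "(Z has_vector_derivative (\<chi> k. 1 * u $ k)) (at 0)"
      unfolding Z_def[abs_def]
      by (intro has_vector_derivative_vec has_vector_derivative_mult_left circle_int_has_vector_derivative)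
    moreover have "(S has_vector_derivative (\<Sum>k\<in>UNIV. (cmod (u $ k))\<^sup>2 * 0)) (at 0)"
      unfolding S_def[abs_def]
      by (intro has_vector_derivative_sum has_vector_derivative_mult_right circle_int_area_has_vector_derivative)
    then have "(C has_vector_derivative 1 * c + 1 / 2 * (\<Sum>k\<in>UNIV. (cmod (u $ k))\<^sup>2 * 0)) (at 0)"
      unfolding C_def[abs_def]
      by (intro has_vector_derivative_add has_vector_derivative_mult_right has_vector_derivative_mult_left
          has_vector_derivative_id)
    moreover have "((\<lambda>r. r *\<^sub>R t) has_vector_derivative 1 *\<^sub>R t) (at 0)"
      by (auto intro!: derivative_eq_intros simp: has_vector_derivative_def)
    ultimately show "((\<lambda>r. (r *\<^sub>R t, Z r, C r)) has_vector_derivative (t, u, c)) (at 0)"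
      by (auto intro!: has_vector_derivative_Pair)
  qed
  then show ?thesis by blast
qed

text \<open>The orbit map involves a separate description for every \<open>s *\<^sub>R X\<close>.
  Running \<open>g\<close> at speed \<open>s\<close> gives a subgroup of that velocity, so by
  uniqueness all these exponentials lie on one curve.\<close>

lemma diamond_exp_curve:
  assumes lin: "\<And>k. linear (alpha k)"
  obtains g where "one_parameter_subgroup alpha X g" "\<And>s. diamond_exp alpha (s *\<^sub>R X) = g s"
proof -
  obtain g where g: "one_parameter_subgroup alpha X g"
    using one_parameter_subgroup_exists[where alpha = alpha, OF lin, where t = "fst X" and u = "fst (snd X)" and c = "snd (snd X)"] by auto
  have "diamond_exp alpha (s *\<^sub>R X) = g s" for s
  proof -
    have gd: "(g has_vector_derivative X) (at 0)" and add: "g (r + r') = diamond_mult alpha (g r) (g r')" for r r'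
      using g unfolding one_parameter_subgroup_def by blast+
    have "((\<lambda>r. s * r) has_vector_derivative s) (at 0)"
      by (auto intro!: derivative_eq_intros simp: has_vector_derivative_def)
    from vector_diff_chain_at[OF this, of g X] gd
    have "((\<lambda>r. g (s * r)) has_vector_derivative s *\<^sub>R X) (at 0)" by (simp add: o_def)
    then have sg: "one_parameter_subgroup alpha (s *\<^sub>R X) (\<lambda>r. g (s * r))"
      unfolding one_parameter_subgroup_def distrib_left using add by blast
    have "(THE g. one_parameter_subgroup alpha (s *\<^sub>R X) g) = (\<lambda>r. g (s * r))"
      by (rule the_equality, rule sg, rule one_parameter_subgroup_unique[where alpha = alpha, OF lin _ sg])
    then show ?thesis by (simp add: diamond_exp_def)
  qed
  with g show ?thesis by (rule that)
qed

subsection \<open>The derived representation on coherent states\<close>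

lemma integrable_square_diff_fock:
  fixes f h :: "complex ^ 'n::finite \<Rightarrow> complex"
  assumes [measurable]: "f \<in> borel_measurable borel" "h \<in> borel_measurable borel"
    and "integrable (fock_measure lam) (\<lambda>z. (norm (f z))\<^sup>2 * exp (- lam * (norm z)\<^sup>2 / 2))"
    and "integrable (fock_measure lam) (\<lambda>z. (norm (h z))\<^sup>2 * exp (- lam * (norm z)\<^sup>2 / 2))"
  shows "integrable (fock_measure lam) (\<lambda>z. (norm (f z - h z))\<^sup>2 * exp (- lam * (norm z)\<^sup>2 / 2))"
proof (rule Bochner_Integration.integrable_bound)
  show "integrable (fock_measure lam) (\<lambda>z. 2 * ((norm (f z))\<^sup>2 * exp (- lam * (norm z)\<^sup>2 / 2))
      + 2 * ((norm (h z))\<^sup>2 * exp (- lam * (norm z)\<^sup>2 / 2)))"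
    using assms by (intro Bochner_Integration.integrable_add integrable_mult_right)
  show "AE z in fock_measure lam. norm ((norm (f z - h z))\<^sup>2 * exp (- lam * (norm z)\<^sup>2 / 2))
      \<le> norm (2 * ((norm (f z))\<^sup>2 * exp (- lam * (norm z)\<^sup>2 / 2))
      + 2 * ((norm (h z))\<^sup>2 * exp (- lam * (norm z)\<^sup>2 / 2)))"
  proof (rule AE_I2)
    fix z
    have "(norm (f z - h z))\<^sup>2 \<le> (norm (f z) + norm (h z))\<^sup>2"
      by (intro power_mono norm_triangle_ineq4) auto
    also have "\<dots> \<le> 2 * (norm (f z))\<^sup>2 + 2 * (norm (h z))\<^sup>2"
      using sum_squares_bound[of "norm (f z)" "norm (h z)"] by (simp add: power2_sum)
    finally have "(norm (f z - h z))\<^sup>2 * exp (- lam * (norm z)\<^sup>2 / 2)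
        \<le> (2 * (norm (f z))\<^sup>2 + 2 * (norm (h z))\<^sup>2) * exp (- lam * (norm z)\<^sup>2 / 2)"
      by (rule mult_right_mono) simp
    then show "norm ((norm (f z - h z))\<^sup>2 * exp (- lam * (norm z)\<^sup>2 / 2))
      \<le> norm (2 * ((norm (f z))\<^sup>2 * exp (- lam * (norm z)\<^sup>2 / 2))
      + 2 * ((norm (h z))\<^sup>2 * exp (- lam * (norm z)\<^sup>2 / 2)))"
      by (simp add: distrib_right mult.assoc)
  qed
qed simp

lemma fock_norm_power2:
  "(fock_norm lam f)\<^sup>2 = (\<integral>z. (norm (f z))\<^sup>2 * exp (- lam * (norm z)\<^sup>2 / 2) \<partial>fock_measure lam)"
proof -
  have "f z * cnj (f z) * of_real (exp (- lam * (norm z)\<^sup>2 / 2)) =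
      complex_of_real ((norm (f z))\<^sup>2 * exp (- lam * (norm z)\<^sup>2 / 2))" for z
    unfolding of_real_mult complex_norm_square ..
  then have "fock_inner lam f f = of_real (\<integral>z. (norm (f z))\<^sup>2 * exp (- lam * (norm z)\<^sup>2 / 2) \<partial>fock_measure lam)"
    unfolding fock_inner_def by (simp only: integral_complex_of_real)
  moreover have "0 \<le> (\<integral>z. (norm (f z))\<^sup>2 * exp (- lam * (norm z)\<^sup>2 / 2) \<partial>fock_measure lam)"
    by (intro Bochner_Integration.integral_nonneg) simp
  ultimately show ?thesis by (simp add: fock_norm_def)
qed

lemma holomorphic_vec_continuous: "holomorphic_vec f \<Longrightarrow> continuous_on UNIV f"
  unfolding holomorphic_vec_def continuous_on_eq_continuous_at[OF open_UNIV]
  using has_derivative_continuous by blast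

text \<open>The set where \<open>f\<close> does not vanish is open, and a nonempty open set is not
  negligible.\<close>

lemma continuous_AE_lborel_zero:
  fixes f :: "'a::euclidean_space \<Rightarrow> 'b::real_normed_vector"
  assumes cont: "continuous_on UNIV f" and ae: "AE x in lborel. f x = 0"
  shows "f x = 0"
proof -
  have o: "open {x. f x \<noteq> 0}"
    using cont by (intro open_Collect_neq continuous_on_const)
  then have "{x. f x \<noteq> 0} \<in> sets lborel" by simp
  with ae have "{x. f x \<noteq> 0} \<in> null_sets lborel"
    by (simp add: AE_iff_null_sets[of "{x. f x \<noteq> 0}"])
  then have "negligible {x. f x \<noteq> 0}"
    by (simp add: negligible_iff_null_sets null_sets_completionI)
  with open_not_negligible[OF o] show ?thesis by blast
qed

text \<open>The growth condition on \<open>F s\<close> secures square integrability; otherwise the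
  integral inside \<open>fock_norm\<close> could be 0 by default and the limits would say nothing.
  Elements of \<open>fock_space\<close> are functions rather than classes, so equality almost
  everywhere is upgraded by continuity.\<close>

lemma fock_norm_limit_unique:
  fixes F :: "real \<Rightarrow> complex ^ 'n::finite \<Rightarrow> complex"
  assumes lam: "lam > 0" and F: "\<And>s. exp_growth (F s)"
    and h: "h1 \<in> fock_space lam" "h2 \<in> fock_space lam"
    and lim: "((\<lambda>s. fock_norm lam (\<lambda>z. F s z - h1 z)) \<longlongrightarrow> 0) (at 0)"
      "((\<lambda>s. fock_norm lam (\<lambda>z. F s z - h2 z)) \<longlongrightarrow> 0) (at 0)"
  shows "h1 = h2"
proof -
  let ?G = "\<lambda>z :: complex ^ 'n. exp (- lam * (norm z)\<^sup>2 / 2)"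
  have cont: "continuous_on UNIV h1" "continuous_on UNIV h2"
    using h by (auto simp: fock_space_def intro: holomorphic_vec_continuous)
  have [measurable]: "h1 \<in> borel_measurable borel" "h2 \<in> borel_measurable borel"
    using cont by (auto intro: borel_measurable_continuous_onI)
  have [measurable]: "F s \<in> borel_measurable borel" for s by (rule exp_growth_measurable[OF F])
  have intF: "integrable (fock_measure lam) (\<lambda>z. (norm (F s z))\<^sup>2 * ?G z)" for s
    using integrable_exp_growth_fock[OF exp_growth_mult[OF exp_growth_norm[OF F] exp_growth_norm[OF F]] lam]
    by (simp add: power2_eq_square)
  have inth: "integrable (fock_measure lam) (\<lambda>z. (norm (h1 z))\<^sup>2 * ?G z)"
    "integrable (fock_measure lam) (\<lambda>z. (norm (h2 z))\<^sup>2 * ?G z)"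
    using h by (auto simp: fock_space_def)
  have int1: "integrable (fock_measure lam) (\<lambda>z. (norm (F s z - h1 z))\<^sup>2 * ?G z)"
    and int2: "integrable (fock_measure lam) (\<lambda>z. (norm (F s z - h2 z))\<^sup>2 * ?G z)" for s
    by (intro integrable_square_diff_fock intF inth; simp)+
  have int: "integrable (fock_measure lam) (\<lambda>z. (norm (h1 z - h2 z))\<^sup>2 * ?G z)"
    by (intro integrable_square_diff_fock inth) auto
  have le: "(\<integral>z. (norm (h1 z - h2 z))\<^sup>2 * ?G z \<partial>fock_measure lam)
      \<le> 2 * (fock_norm lam (\<lambda>z. F s z - h1 z))\<^sup>2 + 2 * (fock_norm lam (\<lambda>z. F s z - h2 z))\<^sup>2" for s
  proof -
    have pw: "(norm (h1 z - h2 z))\<^sup>2 * ?G z \<le> 2 * ((norm (F s z - h1 z))\<^sup>2 * ?G z) + 2 * ((norm (F s z - h2 z))\<^sup>2 * ?G z)" for z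
    proof -
      have "(norm (h1 z - h2 z))\<^sup>2 \<le> (norm (F s z - h2 z) + norm (F s z - h1 z))\<^sup>2"
        using norm_triangle_ineq4[of "F s z - h2 z" "F s z - h1 z"] by (intro power_mono) auto
      also have "\<dots> \<le> 2 * (norm (F s z - h1 z))\<^sup>2 + 2 * (norm (F s z - h2 z))\<^sup>2"
        using sum_squares_bound[of "norm (F s z - h2 z)" "norm (F s z - h1 z)"] by (simp add: power2_sum)
      finally have "(norm (h1 z - h2 z))\<^sup>2 * ?G z \<le> (2 * (norm (F s z - h1 z))\<^sup>2 + 2 * (norm (F s z - h2 z))\<^sup>2) * ?G z"
        by (rule mult_right_mono) simp
      then show ?thesis by (simp add: distrib_right mult.assoc)
    qed
    have "(\<integral>z. (norm (h1 z - h2 z))\<^sup>2 * ?G z \<partial>fock_measure lam)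
        \<le> (\<integral>z. 2 * ((norm (F s z - h1 z))\<^sup>2 * ?G z) + 2 * ((norm (F s z - h2 z))\<^sup>2 * ?G z) \<partial>fock_measure lam)"
      by (intro integral_mono int Bochner_Integration.integrable_add integrable_mult_right int1 int2 pw)
    also have "\<dots> = 2 * (\<integral>z. (norm (F s z - h1 z))\<^sup>2 * ?G z \<partial>fock_measure lam)
        + 2 * (\<integral>z. (norm (F s z - h2 z))\<^sup>2 * ?G z \<partial>fock_measure lam)"
      by (subst Bochner_Integration.integral_add)
        (intro integrable_mult_right int1 int2, intro integrable_mult_right int1 int2,
          simp only: integral_mult_right_zero)
    finally show ?thesis by (simp only: fock_norm_power2)
  qed
  have "((\<lambda>s. 2 * (fock_norm lam (\<lambda>z. F s z - h1 z))\<^sup>2 + 2 * (fock_norm lam (\<lambda>z. F s z - h2 z))\<^sup>2)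
      \<longlongrightarrow> 2 * 0\<^sup>2 + 2 * 0\<^sup>2) (at 0)"
    by (intro tendsto_intros lim)
  then have "(\<integral>z. (norm (h1 z - h2 z))\<^sup>2 * ?G z \<partial>fock_measure lam) \<le> 2 * 0\<^sup>2 + 2 * 0\<^sup>2"
    by (rule tendsto_lowerbound) (intro always_eventually allI le, simp)
  also have "2 * 0\<^sup>2 + 2 * 0\<^sup>2 = (0 :: real)" by simp
  finally have le0: "(\<integral>z. (norm (h1 z - h2 z))\<^sup>2 * ?G z \<partial>fock_measure lam) \<le> 0" .
  have "0 \<le> (\<integral>z. (norm (h1 z - h2 z))\<^sup>2 * ?G z \<partial>fock_measure lam)"
    by (intro Bochner_Integration.integral_nonneg) simp
  with le0 have "(\<integral>z. (norm (h1 z - h2 z))\<^sup>2 * ?G z \<partial>fock_measure lam) = 0" by (rule antisym)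
  then have "AE z in fock_measure lam. (norm (h1 z - h2 z))\<^sup>2 * ?G z = 0"
    by (subst (asm) integral_nonneg_eq_0_iff_AE[OF int]) auto
  then have "AE z in lborel. h1 z - h2 z = 0"
    using lam unfolding fock_measure_def by (subst (asm) AE_density) auto
  then have "h1 z - h2 z = 0" for z
    by (rule continuous_AE_lborel_zero[rotated]) (intro continuous_on_diff cont)
  then show ?thesis by (simp add: fun_eq_iff)
qed

section \<open>The orbit of a coherent state and its velocity\<close>

lemma bil_add_left: "bil (p + p') v = bil p v + bil p' v"
  by (rule bounded_bilinear.add_left[OF bounded_bilinear_bil])

lemma bil_diff_left: "bil (p - p') v = bil p v - bil p' v"
  by (rule bounded_bilinear.diff_left[OF bounded_bilinear_bil])

lemma bil_add_right: "bil p (v + v') = bil p v + bil p v'"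
  by (rule bounded_bilinear.add_right[OF bounded_bilinear_bil])

lemma bil_diff_right: "bil p (v - v') = bil p v - bil p v'"
  by (rule bounded_bilinear.diff_right[OF bounded_bilinear_bil])

text \<open>The derivative at 0 of the scalar in \<open>diamond_rep_coherent\<close> along the
  subgroup. The term quadratic in the second group coordinate contributes nothing, as that
  coordinate starts at 0.\<close>

definition derived_const ::
  "(real ^ 'm::finite \<Rightarrow> complex) \<Rightarrow> real \<Rightarrow> real ^ 'm \<Rightarrow> complex ^ 'n::finite \<Rightarrow> real \<Rightarrow> complex ^ 'n \<Rightarrow> complex" where
  "derived_const chi lam t u c w = frechet_derivative chi (at 0) t + \<i> * of_real lam * of_real c
     - of_real lam / 2 * bil (cnj_vec w) u"

text \<open>The derivative at 0 of the exponent vector: up to conjugation and the factor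
  \<open>lam / 2\<close>, the velocity of \<open>w\<close> under the affine action of the
  group.\<close>

definition derived_slope ::
  "('n::finite \<Rightarrow> real ^ 'm::finite \<Rightarrow> real) \<Rightarrow> real \<Rightarrow> real ^ 'm \<Rightarrow> complex ^ 'n \<Rightarrow> complex ^ 'n \<Rightarrow> complex ^ 'n" where
  "derived_slope alpha lam t u w = (lam / 2) *\<^sub>R cnj_vec (u + (\<chi> k. \<i> * of_real (alpha k t) * w $ k))"

definition derived_coherent where
  "derived_coherent alpha chi lam t u c w =
     (\<lambda>v. (derived_const chi lam t u c w + bil (derived_slope alpha lam t u w) v) * coherent lam w v)"

text \<open>Since the torus acts unitarily, it can be moved to the other argument of the pairing
  with \<open>cnj_vec w\<close>. The result is a multiple of the coherent state at the transformed
  point \<open>Z + torus_act alpha T w\<close>.\<close>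

lemma diamond_rep_coherent:
  assumes lin: "\<And>k. linear (alpha k)"
  shows "diamond_rep alpha chi lam (T, Z, C) (coherent lam w) v =
    (chi T * exp (\<i> * of_real lam * of_real C - of_real lam / 4 * bil Z (cnj_vec Z)
        - of_real lam / 2 * bil (cnj_vec w) (torus_act alpha (- T) Z))) *
    exp (bil ((lam / 2) *\<^sub>R cnj_vec (Z + torus_act alpha T w)) v)"
proof -
  have act: "bil (cnj_vec w) (torus_act alpha (- T) v') = bil (cnj_vec (torus_act alpha T w)) v'" for v'
    unfolding bil_def by (rule sum.cong) (simp_all add: cnj_vec_def torus_act_def exp_cnj linear_neg[OF lin])
  have cnj_add: "cnj_vec (a + b) = cnj_vec a + cnj_vec b" for a b :: "complex ^ 'a"
    by (simp add: cnj_vec_def vec_eq_iff)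
  have "coherent lam w (torus_act alpha (- T) (v - Z)) =
    exp (of_real lam / 2 * (bil (cnj_vec (torus_act alpha T w)) v - bil (cnj_vec w) (torus_act alpha (- T) Z)))"
    unfolding coherent_def act bil_diff_right by simp
  moreover have "bil ((lam / 2) *\<^sub>R cnj_vec (Z + torus_act alpha T w)) v =
      of_real lam / 2 * (bil (cnj_vec Z) v + bil (cnj_vec (torus_act alpha T w)) v)"
    unfolding bil_scaleR cnj_add bil_add_left by simp
  ultimately show ?thesis
    by (simp only: diamond_rep.simps bil_cnj_vec_self[symmetric] mult.assoc exp_add[symmetric])
      (simp add: algebra_simps)
qed

lemma has_vector_derivative_torus_act:
  assumes T: "(T has_vector_derivative t) (at 0)" and T0: "T 0 = 0"
    and lin: "\<And>k. linear (alpha k)"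
    and Z: "(Z has_vector_derivative u) (at 0)"
  shows "((\<lambda>s. torus_act alpha (T s) (Z s)) has_vector_derivative (\<chi> k. u $ k + \<i> * of_real (alpha k t) * Z 0 $ k)) (at 0)"
proof -
  have "((\<lambda>s. exp (\<i> * of_real (alpha k (T s))) * Z s $ k) has_vector_derivative u $ k + \<i> * of_real (alpha k t) * Z 0 $ k) (at 0)" for k
  proof -
    have "bounded_linear (alpha k)" using lin[of k] by (simp add: linear_conv_bounded_linear)
    from bounded_linear.has_vector_derivative[OF this T]
    have "((\<lambda>s. \<i> * of_real (alpha k (T s))) has_vector_derivative \<i> * of_real (alpha k t)) (at 0)"
      by (intro has_vector_derivative_mult_right has_vector_derivative_of_real)
        (simp add: has_real_derivative_iff_has_vector_derivative)
    from field_vector_diff_chain_at[OF this DERIV_exp]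
    have e: "((\<lambda>s. exp (\<i> * of_real (alpha k (T s)))) has_vector_derivative \<i> * of_real (alpha k t)) (at 0)"
      by (simp add: o_def T0 linear_0[OF lin])
    from has_vector_derivative_mult[OF e bounded_linear.has_vector_derivative[OF bounded_linear_vec_nth Z, of k]]
    show ?thesis by (simp add: T0 linear_0[OF lin])
  qed
  then show ?thesis unfolding torus_act_def by (rule has_vector_derivative_vec)
qed

text \<open>The second claim is uniqueness: any other candidate is a limit of the same difference
  quotients, and these have exponential growth.\<close>

lemma has_derived_rep_coherent:
  assumes lam: "lam > 0" and lin: "\<And>k. linear (alpha k)" and chi: "unitary_character chi"
  shows "has_derived_rep alpha chi lam (t, u, c) (coherent lam w) (derived_coherent alpha chi lam t u c w)"
    and "has_derived_rep alpha chi lam (t, u, c) (coherent lam w) h \<Longrightarrow> h = derived_coherent alpha chi lam t u c w"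
proof -
  obtain g where g: "one_parameter_subgroup alpha (t, u, c) g"
    and exp_g: "\<And>s. diamond_exp alpha (s *\<^sub>R (t, u, c)) = g s"
    using diamond_exp_curve[where alpha = alpha, OF lin] by metis
  define T Z C where "T = (\<lambda>s. fst (g s))" and "Z = (\<lambda>s. fst (snd (g s)))" and "C = (\<lambda>s. snd (snd (g s)))"
  have g_eq: "g s = (T s, Z s, C s)" for s by (simp add: T_def Z_def C_def)
  note comp = one_parameter_subgroup_components[where alpha = alpha, OF lin g]
  have T0: "T 0 = 0" and Z0: "Z 0 = 0" and C0: "C 0 = 0"
    using comp(1-3) by (simp_all add: T_def Z_def C_def)
  have act0: "torus_act alpha 0 v = v" for v by (rule torus_act_zero[where alpha = alpha, OF lin])
  have bil0: "bil 0 v = 0" "bil v 0 = 0" "cnj_vec 0 = (0 :: complex ^ 'a)" for v :: "complex ^ 'a"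
    by (simp_all add: bounded_bilinear.zero_left[OF bounded_bilinear_bil]
        bounded_bilinear.zero_right[OF bounded_bilinear_bil] cnj_vec_def vec_eq_iff)
  have T': "(T has_vector_derivative t) (at 0)" unfolding T_def by (rule comp(4))
  have Z': "(Z has_vector_derivative u) (at 0)"
    using comp(5)[of 0] unfolding Z_def comp(1) act0 .
  have C': "(C has_vector_derivative c) (at 0)"
    using comp(6)[of 0] unfolding C_def comp(1,2) act0 by (simp add: omega_def bil0)
  define \<kappa> where "\<kappa> s = chi (T s) * exp (\<i> * of_real lam * of_real (C s) - of_real lam / 4 * bil (Z s) (cnj_vec (Z s))
        - of_real lam / 2 * bil (cnj_vec w) (torus_act alpha (- T s) (Z s)))" for s
  define q where "q s = (lam / 2) *\<^sub>R cnj_vec (Z s + torus_act alpha (T s) w)" for s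
  have rep: "diamond_rep alpha chi lam (diamond_exp alpha (s *\<^sub>R (t, u, c))) (coherent lam w) v = \<kappa> s * exp (bil (q s) v)" for s v
    unfolding exp_g g_eq \<kappa>_def q_def by (rule diamond_rep_coherent[where alpha = alpha, OF lin])
  have \<kappa>0: "\<kappa> 0 = 1"
    by (simp add: \<kappa>_def T0 Z0 C0 bil0 act0 unitary_character_zero[OF chi])
  have q0: "q 0 = (lam / 2) *\<^sub>R cnj_vec w" by (simp add: q_def T0 Z0 act0)
  have "(q has_vector_derivative derived_slope alpha lam t u w) (at 0)"
  proof -
    have "((\<lambda>s. torus_act alpha (T s) w) has_vector_derivative (\<chi> k. \<i> * of_real (alpha k t) * w $ k)) (at 0)"
      using has_vector_derivative_torus_act[where alpha = alpha, OF T' T0 lin has_vector_derivative_const[of w]] by simp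
    from has_vector_derivative_add[OF Z' this]
    have "((\<lambda>s. cnj_vec (Z s + torus_act alpha (T s) w)) has_vector_derivative cnj_vec (u + (\<chi> k. \<i> * of_real (alpha k t) * w $ k))) (at 0)"
      by (rule bounded_linear.has_vector_derivative[OF bounded_linear_cnj_vec])
    from bounded_linear.has_vector_derivative[OF bounded_linear_scaleR_right this]
    show ?thesis unfolding q_def[abs_def] derived_slope_def .
  qed
  moreover have "(\<kappa> has_vector_derivative derived_const chi lam t u c w) (at 0)"
  proof -
    have "(chi has_derivative frechet_derivative chi (at 0)) (at (T 0))"
      unfolding T0 using unitary_character_differentiable[OF chi] by (simp add: frechet_derivative_works)
    then have "(chi has_derivative frechet_derivative chi (at 0)) (at (T 0) within range T)"
      by (rule has_derivative_at_withinI)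
    from vector_derivative_diff_chain_within[OF T' this]
    have chi': "((\<lambda>s. chi (T s)) has_vector_derivative frechet_derivative chi (at 0) t) (at 0)" by (simp add: o_def)
    define E where "E s = \<i> * of_real lam * of_real (C s) - of_real lam / 4 * bil (Z s) (cnj_vec (Z s))
        - of_real lam / 2 * bil (cnj_vec w) (torus_act alpha (- T s) (Z s))" for s
    have E0: "E 0 = 0" by (simp add: E_def T0 Z0 C0 bil0 act0)
    have 1: "((\<lambda>s. bil (Z s) (cnj_vec (Z s))) has_vector_derivative bil (Z 0) (cnj_vec u) + bil u (cnj_vec (Z 0))) (at 0)"
      by (rule bounded_bilinear.has_vector_derivative[OF bounded_bilinear_bil Z'
          bounded_linear.has_vector_derivative[OF bounded_linear_cnj_vec Z']])
    have "((\<lambda>s. torus_act alpha (- T s) (Z s)) has_vector_derivative (\<chi> k. u $ k + \<i> * of_real (alpha k (- t)) * Z 0 $ k)) (at 0)"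
      by (rule has_vector_derivative_torus_act[where alpha = alpha, OF _ _ lin Z'])
        (auto intro: has_vector_derivative_minus T' simp: T0)
    then have "((\<lambda>s. torus_act alpha (- T s) (Z s)) has_vector_derivative u) (at 0)" by (simp add: Z0)
    from bounded_linear.has_vector_derivative[OF bounded_bilinear.bounded_linear_right[OF bounded_bilinear_bil] this]
    have 2: "((\<lambda>s. bil (cnj_vec w) (torus_act alpha (- T s) (Z s))) has_vector_derivative bil (cnj_vec w) u) (at 0)" .
    have "(E has_vector_derivative \<i> * of_real lam * of_real c - of_real lam / 4 * (bil (Z 0) (cnj_vec u) + bil u (cnj_vec (Z 0)))
        - of_real lam / 2 * bil (cnj_vec w) u) (at 0)"
      unfolding E_def[abs_def]
      by (intro has_vector_derivative_diff has_vector_derivative_mult_right has_vector_derivative_of_real 1 2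
          C'[folded has_real_derivative_iff_has_vector_derivative])
    then have "(E has_vector_derivative \<i> * of_real lam * of_real c - of_real lam / 2 * bil (cnj_vec w) u) (at 0)"
      by (simp add: Z0 bil0)
    from field_vector_diff_chain_at[OF this DERIV_exp]
    have "((\<lambda>s. exp (E s)) has_vector_derivative \<i> * of_real lam * of_real c - of_real lam / 2 * bil (cnj_vec w) u) (at 0)"
      by (simp add: o_def E0)
    from has_vector_derivative_mult[OF chi' this]
    have "((\<lambda>s. chi (T s) * exp (E s)) has_vector_derivative derived_const chi lam t u c w) (at 0)"
      by (simp add: E0 T0 unitary_character_zero[OF chi] derived_const_def add.commute add_diff_eq)
    then show ?thesis unfolding \<kappa>_def[abs_def] E_def .
  qed
  ultimately have lim0: "((\<lambda>s. fock_norm lam (\<lambda>v. (\<kappa> s * exp (bil (q s) v) - \<kappa> 0 * exp (bil (q 0) v)) / of_real s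
            - (derived_const chi lam t u c w + \<kappa> 0 * bil (derived_slope alpha lam t u w) v) * exp (bil (q 0) v))) \<longlongrightarrow> 0) (at 0)"
    using fock_norm_difference_quotient lam by blast
  let ?F = "\<lambda>s v. (diamond_rep alpha chi lam (diamond_exp alpha (s *\<^sub>R (t, u, c))) (coherent lam w) v - coherent lam w v) / of_real s"
  have coh: "coherent lam w v = exp (bil (q 0) v)" for v by (simp add: coherent_eq q0)
  have lim: "((\<lambda>s. fock_norm lam (\<lambda>v. ?F s v - derived_coherent alpha chi lam t u c w v)) \<longlongrightarrow> 0) (at 0)"
    using lim0 unfolding \<kappa>0 mult_1 rep coh derived_coherent_def .
  have der: "derived_coherent alpha chi lam t u c w \<in> fock_space lam"
    unfolding derived_coherent_def coherent_eq by (rule affine_exp_bil_in_fock_space[OF lam])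
  show "has_derived_rep alpha chi lam (t, u, c) (coherent lam w) (derived_coherent alpha chi lam t u c w)"
    unfolding has_derived_rep_def using lim der coherent_in_fock_space[OF lam] by blast
  assume "has_derived_rep alpha chi lam (t, u, c) (coherent lam w) h"
  then have h: "h \<in> fock_space lam" and limh: "((\<lambda>s. fock_norm lam (\<lambda>v. ?F s v - h v)) \<longlongrightarrow> 0) (at 0)"
    unfolding has_derived_rep_def by blast+
  have "?F s = (\<lambda>v. (\<kappa> s * exp (bil (q s) v) - exp (bil (q 0) v)) * (1 / of_real s))" for s
    unfolding rep coh by simp
  then have "exp_growth (?F s)" for s
    by (simp only:) (intro exp_growth_mult exp_growth_diff exp_growth_const exp_growth_exp_bil)
  from fock_norm_limit_unique[OF lam this h der limh lim]
  show "h = derived_coherent alpha chi lam t u c w" .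
qed

lemma derived_rep_coherent:
  assumes "lam > 0" and "\<And>k. linear (alpha k)" and "unitary_character chi"
  shows "coherent lam w \<in> derived_domain alpha chi lam (t, u, c)"
    and "derived_rep alpha chi lam (t, u, c) (coherent lam w) = derived_coherent alpha chi lam t u c w"
proof -
  note d = has_derived_rep_coherent[where alpha = alpha and chi = chi, OF assms]
  show "coherent lam w \<in> derived_domain alpha chi lam (t, u, c)"
    unfolding derived_domain_def mem_Collect_eq by (rule ex1I, rule d(1), rule d(2))
  show "derived_rep alpha chi lam (t, u, c) (coherent lam w) = derived_coherent alpha chi lam t u c w"
    unfolding derived_rep_def by (rule the_equality, rule d(1), rule d(2))
qed

lemma fock_inner_derived_coherent:
  assumes "lam > 0"
  shows "fock_inner lam (derived_coherent alpha chi lam t u c w) (coherent lam z) =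
    (derived_const chi lam t u c w + bil (derived_slope alpha lam t u w) z) * coherent lam w z"
  unfolding derived_coherent_def unfolding coherent_eq[of lam w]
  by (rule fock_inner_affine_exp_bil_coherent[OF assms])

subsection \<open>The symbols\<close>

lemma integral_lborel_odd:
  fixes f :: "'a::euclidean_space \<Rightarrow> 'b::{banach, second_countable_topology}"
  assumes [measurable]: "f \<in> borel_measurable borel" and odd: "\<And>v. f (- v) = - f v"
  shows "integral\<^sup>L lborel f = 0"
proof -
  have "lborel = distr lborel borel (uminus :: 'a \<Rightarrow> 'a)"
    using lborel_affine[of "- 1" "0 :: 'a"] by (simp add: density_1)
  then have "integral\<^sup>L lborel f = integral\<^sup>L (distr lborel borel uminus) f" by simp
  also have "\<dots> = - integral\<^sup>L lborel f" by (subst integral_distr) (simp_all add: odd)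
  finally have "2 *\<^sub>R integral\<^sup>L lborel f = 0" by (simp add: scaleR_2 eq_neg_iff_add_eq_0)
  then show ?thesis by simp
qed

text \<open>A splitting by degree in \<open>w\<close>. Conjugating
  \<open>\<i> * (z $ k - w $ k)\<close> and multiplying by \<open>z $ k + w $ k\<close> gives the
  two squares opposite signs, hence the plus sign of the last sum. At \<open>w = 0\<close> only the
  Berezin part remains.\<close>

lemma derived_symbol_polynomial:
  "derived_const chi lam t u c (z - w) + bil (derived_slope alpha lam t u (z - w)) (z + w) =
     (frechet_derivative chi (at 0) t + \<i> * of_real lam * of_real c
       + of_real lam / 2 * (bil (cnj_vec u) z - bil (cnj_vec z) u)
       - of_real lam / 2 * \<i> * (\<Sum>k\<in>UNIV. of_real (alpha k t) * of_real ((cmod (z $ k))\<^sup>2)))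
     + (bil (\<chi> k. of_real lam / 2 * (cnj (u $ k) - \<i> * of_real (alpha k t) * cnj (z $ k))) w
       + bil (\<chi> k. of_real lam / 2 * (u $ k + \<i> * of_real (alpha k t) * z $ k)) (cnj_vec w))
     + of_real lam / 2 * \<i> * (\<Sum>k\<in>UNIV. of_real (alpha k t) * of_real ((cmod (w $ k))\<^sup>2))"
proof -
  have "- bil (cnj_vec (z - w)) u + bil (cnj_vec (u + (\<chi> k. \<i> * of_real (alpha k t) * (z - w) $ k))) (z + w) =
    (\<Sum>k\<in>UNIV. - (cnj (z $ k - w $ k) * u $ k) + cnj (u $ k + \<i> * of_real (alpha k t) * (z $ k - w $ k)) * (z $ k + w $ k))"
    by (simp add: bil_def cnj_vec_def sum_negf sum.distrib sum_subtractf)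
  also have "\<dots> = (\<Sum>k\<in>UNIV. (cnj (u $ k) * z $ k - cnj (z $ k) * u $ k)
        - \<i> * (of_real (alpha k t) * of_real ((cmod (z $ k))\<^sup>2))
        + ((cnj (u $ k) - \<i> * of_real (alpha k t) * cnj (z $ k)) * w $ k
          + (u $ k + \<i> * of_real (alpha k t) * z $ k) * cnj (w $ k))
        + \<i> * (of_real (alpha k t) * of_real ((cmod (w $ k))\<^sup>2)))"
    by (intro sum.cong refl) (unfold complex_norm_square, simp add: algebra_simps)
  also have "\<dots> = (bil (cnj_vec u) z - bil (cnj_vec z) u)
        - \<i> * (\<Sum>k\<in>UNIV. of_real (alpha k t) * of_real ((cmod (z $ k))\<^sup>2))
        + (bil (\<chi> k. cnj (u $ k) - \<i> * of_real (alpha k t) * cnj (z $ k)) w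
          + bil (\<chi> k. u $ k + \<i> * of_real (alpha k t) * z $ k) (cnj_vec w))
        + \<i> * (\<Sum>k\<in>UNIV. of_real (alpha k t) * of_real ((cmod (w $ k))\<^sup>2))"
    unfolding sum.distrib sum_subtractf sum_distrib_left[symmetric] by (simp add: bil_def cnj_vec_def)
  finally have *: "- bil (cnj_vec (z - w)) u + bil (cnj_vec (u + (\<chi> k. \<i> * of_real (alpha k t) * (z - w) $ k))) (z + w) = \<dots>" .
  have scale: "bil (\<chi> k. of_real lam / 2 * f k) v = of_real lam / 2 * bil (\<chi> k. f k) v" for f :: "'b \<Rightarrow> complex" and v
    by (simp add: bil_def sum_distrib_left mult.assoc)
  have "derived_const chi lam t u c (z - w) + bil (derived_slope alpha lam t u (z - w)) (z + w) =
    frechet_derivative chi (at 0) t + \<i> * of_real lam * of_real c + of_real lam / 2 *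
      (- bil (cnj_vec (z - w)) u + bil (cnj_vec (u + (\<chi> k. \<i> * of_real (alpha k t) * (z - w) $ k))) (z + w))"
    by (simp add: derived_const_def derived_slope_def bil_scaleR right_diff_distrib distrib_left)
  then show ?thesis unfolding * scale by (simp add: algebra_simps)
qed

lemma weyl_integrand_derived:
  assumes "lam > 0" and "\<And>k. linear (alpha k)" and "unitary_character chi"
  shows "weyl_integrand lam (derived_rep alpha chi lam (t, u, c)) z w =
    (derived_const chi lam t u c (z - w) + bil (derived_slope alpha lam t u (z - w)) (z + w)) *
      of_real (exp (- lam * (norm w)\<^sup>2))"
proof -
  have cnj_diff: "cnj_vec (z - w) = cnj_vec z - cnj_vec w" by (simp add: cnj_vec_def vec_eq_iff)
  have comm: "bil p q = bil q p" for p q :: "complex ^ 'a" by (simp add: bil_def mult.commute)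
  \<comment> \<open>The exponent of the coherent state is \<open>lam / 2\<close> times the product
    of \<open>cnj_vec (z - w)\<close> and \<open>z + w\<close>. Its square of \<open>z\<close> and
    its mixed terms cancel against the given exponent, while the two squares of \<open>w\<close> add
    up.\<close>
  have "coherent lam (z - w) (z + w) * exp (of_real lam / 2 *
          (- bil z (cnj_vec z) - bil w (cnj_vec w) + bil z (cnj_vec w) - bil (cnj_vec z) w)) =
     exp (- of_real lam * bil w (cnj_vec w))"
    unfolding coherent_def exp_add[symmetric] cnj_diff bil_diff_left bil_add_right
      comm[of "cnj_vec z" z] comm[of "cnj_vec w" w] comm[of "cnj_vec w" z]
    by (rule arg_cong[of _ _ exp]) (simp add: field_simps)
  also have "\<dots> = of_real (exp (- lam * (norm w)\<^sup>2))"
    unfolding bil_cnj_vec_self exp_of_real[symmetric] by simp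
  finally show ?thesis
    unfolding weyl_integrand_def op_kernel_def derived_rep_coherent(2)[where alpha = alpha, OF assms]
      fock_inner_derived_coherent[OF assms(1)]
    by (simp only: mult.assoc)
qed

text \<open>The reproducing property puts the nonzero factor \<open>coherent lam z z\<close> into
  numerator and denominator.\<close>

lemma berezin_symbol_derived:
  assumes "lam > 0" and "\<And>k. linear (alpha k)" and "unitary_character chi"
  shows "berezin_symbol lam (derived_rep alpha chi lam (t, u, c)) z =
    derived_const chi lam t u c z + bil (derived_slope alpha lam t u z) z"
proof -
  have "fock_inner lam (coherent lam z) (coherent lam z) = coherent lam z z"
    unfolding coherent_eq[of lam z] using fock_inner_exp_bil_coherent[OF assms(1)] by (simp add: coherent_eq)
  moreover have "coherent lam z z \<noteq> 0" by (simp add: coherent_def)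
  ultimately show ?thesis
    unfolding berezin_symbol_def derived_rep_coherent(2)[where alpha = alpha, OF assms]
      fock_inner_derived_coherent[OF assms(1)] by simp
qed

lemma has_bochner_integral_quadratic_gaussian:
  fixes p p' :: "complex ^ 'n::finite" and \<beta> :: "'n \<Rightarrow> complex"
  assumes lam: "lam > 0"
  shows "has_bochner_integral lborel
    (\<lambda>w. (a + (bil p w + bil p' (cnj_vec w)) + b * (\<Sum>k\<in>UNIV. \<beta> k * of_real ((cmod (w $ k))\<^sup>2)))
        * of_real (exp (- lam * (norm w)\<^sup>2)))
    (of_real ((pi / lam) ^ CARD('n)) * (a + b * (\<Sum>k\<in>UNIV. \<beta> k / of_real lam)))"
proof -
  let ?G = "\<lambda>w :: complex ^ 'n. complex_of_real (exp (- lam * (norm w)\<^sup>2))"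
  have const: "has_bochner_integral lborel ?G (of_real ((pi / lam) ^ CARD('n)))"
    using has_bochner_integral_exp_bil_gaussian[OF lam, of "0 :: complex ^ 'n" 0]
    by (simp add: bounded_bilinear.zero_left[OF bounded_bilinear_bil])
  have odd: "has_bochner_integral lborel (\<lambda>w. (bil p w + bil p' (cnj_vec w)) * ?G w) 0"
  proof -
    have "exp_growth (\<lambda>w. bil p w + bil p' (cnj_vec w))"
      by (intro exp_growth_add exp_growth_bil exp_growth_bounded_linear
          bounded_linear_compose[OF bounded_bilinear.bounded_linear_right[OF bounded_bilinear_bil] bounded_linear_cnj_vec])
    from integrable_exp_growth_gaussian[OF this lam]
    have int: "integrable lborel (\<lambda>w. (bil p w + bil p' (cnj_vec w)) * ?G w)" .
    then have "integral\<^sup>L lborel (\<lambda>w. (bil p w + bil p' (cnj_vec w)) * ?G w) = 0"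
      by (intro integral_lborel_odd)
        (auto dest: borel_measurable_integrable simp: bil_def cnj_vec_def sum_negf algebra_simps)
    with int show ?thesis by (simp add: has_bochner_integral_iff)
  qed
  have quad: "has_bochner_integral lborel (\<lambda>w :: complex ^ 'n. of_real ((cmod (w $ k))\<^sup>2 * exp (- lam * (norm w)\<^sup>2)))
      (complex_of_real ((pi / lam) ^ CARD('n) / lam))" for k
    by (intro has_bochner_integral_of_real has_bochner_integral_norm_nth_gaussian lam)
  have "has_bochner_integral lborel
     (\<lambda>w. a * ?G w + (bil p w + bil p' (cnj_vec w)) * ?G w
       + b * (\<Sum>k\<in>UNIV. \<beta> k * of_real ((cmod (w $ k))\<^sup>2 * exp (- lam * (norm w)\<^sup>2))))
     (a * of_real ((pi / lam) ^ CARD('n)) + 0 + b * (\<Sum>k\<in>UNIV. \<beta> k * complex_of_real ((pi / lam) ^ CARD('n) / lam)))"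
    by (intro has_bochner_integral_add has_bochner_integral_mult_right has_bochner_integral_sum const odd quad)
  also have "(\<lambda>w. a * ?G w + (bil p w + bil p' (cnj_vec w)) * ?G w
       + b * (\<Sum>k\<in>UNIV. \<beta> k * of_real ((cmod (w $ k))\<^sup>2 * exp (- lam * (norm w)\<^sup>2)))) =
     (\<lambda>w. (a + (bil p w + bil p' (cnj_vec w)) + b * (\<Sum>k\<in>UNIV. \<beta> k * of_real ((cmod (w $ k))\<^sup>2))) * ?G w)"
    by (simp add: fun_eq_iff distrib_right sum_distrib_right mult.assoc)
  also have "a * of_real ((pi / lam) ^ CARD('n)) + 0 + b * (\<Sum>k\<in>UNIV. \<beta> k * complex_of_real ((pi / lam) ^ CARD('n) / lam)) =
     of_real ((pi / lam) ^ CARD('n)) * (a + b * (\<Sum>k\<in>UNIV. \<beta> k / of_real lam))"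
  proof -
    have "(\<Sum>k\<in>UNIV. \<beta> k * complex_of_real (x / lam)) = of_real x * (\<Sum>k\<in>UNIV. \<beta> k / of_real lam)" for x
      unfolding sum_distrib_left by (intro sum.cong refl) simp
    then show ?thesis by (simp only: distrib_left add_0_right mult.left_commute mult.commute)
  qed
  finally show ?thesis .
qed

text \<open>Domain membership and convergence are claimed as well, because a definite description
  and a Bochner integral have values even where they are meaningless.\<close>

theorem proposition6p4:
  fixes lam :: real
    and alpha :: "'n::finite \<Rightarrow> real ^ 'm::finite \<Rightarrow> real"
    and chi :: "real ^ 'm \<Rightarrow> complex"
    and t :: "real ^ 'm" and u :: "complex ^ 'n" and c :: real
    and z :: "complex ^ 'n"
  assumes "lam > 0"
    and "\<And>k. linear (alpha k)"
    and "unitary_character chi"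
  shows "(\<forall>w. coherent lam w \<in> derived_domain alpha chi lam (t, u, c)) \<and>
     berezin_symbol lam (derived_rep alpha chi lam (t, u, c)) z =
       frechet_derivative chi (at 0) t + \<i> * complex_of_real lam * complex_of_real c
       + complex_of_real lam / 2 * (bil (cnj_vec u) z - bil (cnj_vec z) u)
       - complex_of_real lam / 2 * \<i> * bil (cnj_vec z) (alpha_mult alpha t z) \<and>
     weyl_converges lam (derived_rep alpha chi lam (t, u, c)) z \<and>
     weyl_symbol lam (derived_rep alpha chi lam (t, u, c)) z =
       frechet_derivative chi (at 0) t + \<i> * complex_of_real lam * complex_of_real c
       + complex_of_real lam / 2 * (bil (cnj_vec u) z - bil (cnj_vec z) u)
       + 1 / 2 * \<i> * (\<Sum>k\<in>UNIV. complex_of_real (alpha k t)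
                               * complex_of_real (1 - lam * (norm (z $ k))\<^sup>2))"
proof -
  let ?A = "derived_rep alpha chi lam (t, u, c)"
  let ?zz = "\<Sum>k\<in>UNIV. complex_of_real (alpha k t) * complex_of_real ((cmod (z $ k))\<^sup>2)"
  let ?B = "frechet_derivative chi (at 0) t + \<i> * complex_of_real lam * complex_of_real c
       + complex_of_real lam / 2 * (bil (cnj_vec u) z - bil (cnj_vec z) u)"
  have zz: "bil (cnj_vec z) (alpha_mult alpha t z) = ?zz"
    unfolding bil_def by (intro sum.cong refl) (unfold complex_norm_square, simp add: cnj_vec_def alpha_mult_def)
  have "berezin_symbol lam ?A z = ?B - complex_of_real lam / 2 * \<i> * ?zz"
    using derived_symbol_polynomial[of chi lam t u c z 0 alpha]
    by (simp add: berezin_symbol_derived[where alpha = alpha, OF assms] cnj_vec_def[of 0] zero_vec_def[symmetric]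
        bounded_bilinear.zero_right[OF bounded_bilinear_bil])
  then have berezin: "berezin_symbol lam ?A z = ?B - complex_of_real lam / 2 * \<i> * bil (cnj_vec z) (alpha_mult alpha t z)"
    by (simp only: zz)
  have b: "has_bochner_integral lborel (weyl_integrand lam ?A z)
    (of_real ((pi / lam) ^ CARD('n)) * ((?B - of_real lam / 2 * \<i> * ?zz)
       + of_real lam / 2 * \<i> * (\<Sum>k\<in>UNIV. of_real (alpha k t) / of_real lam)))"
    unfolding weyl_integrand_derived[where alpha = alpha, OF assms, abs_def] derived_symbol_polynomial
    by (rule has_bochner_integral_quadratic_gaussian[OF assms(1)])
  have meas: "weyl_integrand lam ?A z \<in> borel_measurable borel"
    using borel_measurable_has_bochner_integral[OF b] by simp
  have conv: "weyl_converges lam ?A z"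
    unfolding weyl_converges_def using b assms(1) by (auto intro: integrable_fock_measure simp: has_bochner_integral_iff)
  have "weyl_symbol lam ?A z = 2 ^ CARD('n) * ((lam / (2 * pi)) ^ CARD('n) *\<^sub>R
     (of_real ((pi / lam) ^ CARD('n)) * ((?B - of_real lam / 2 * \<i> * ?zz)
       + of_real lam / 2 * \<i> * (\<Sum>k\<in>UNIV. of_real (alpha k t) / of_real lam))))"
    unfolding weyl_symbol_def
    unfolding integral_fock_measure[OF assms(1) meas] has_bochner_integral_integral_eq[OF b] ..
  also have "\<dots> = (?B - of_real lam / 2 * \<i> * ?zz)
       + of_real lam / 2 * \<i> * (\<Sum>k\<in>UNIV. of_real (alpha k t) / of_real lam)"
  proof -
    \<comment> \<open>Under \<open>fock_measure\<close> the Gaussian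
      \<open>exp (- lam * (norm w)\<^sup>2)\<close> has the mass \<open>1 / 2 ^ CARD('n)\<close>;
      the prefactor of the Weyl symbol compensates for this.\<close>
    have "2 ^ CARD('n) * (lam / (2 * pi)) ^ CARD('n) * (pi / lam) ^ CARD('n) = 1"
      using assms(1) by (simp add: power_mult_distrib[symmetric])
    then have "complex_of_real (2 ^ CARD('n)) * of_real ((lam / (2 * pi)) ^ CARD('n)) * of_real ((pi / lam) ^ CARD('n)) = 1"
      by (simp only: of_real_mult[symmetric] of_real_1)
    then have "2 ^ CARD('n) * ((lam / (2 * pi)) ^ CARD('n) *\<^sub>R (complex_of_real ((pi / lam) ^ CARD('n)) * x)) = x" for x
      by (simp add: scaleR_conv_of_real mult.assoc[symmetric])
    then show ?thesis .
  qed
  also have "\<dots> = ?B + 1 / 2 * \<i> * (\<Sum>k\<in>UNIV. complex_of_real (alpha k t)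
                               * complex_of_real (1 - lam * (norm (z $ k))\<^sup>2))"
  proof -
    have 1: "of_real lam * (\<Sum>k\<in>UNIV. complex_of_real (alpha k t) / of_real lam) = (\<Sum>k\<in>UNIV. complex_of_real (alpha k t))"
      unfolding sum_distrib_left using assms(1) by simp
    have 2: "(\<Sum>k\<in>UNIV. complex_of_real (alpha k t) * complex_of_real (1 - lam * (norm (z $ k))\<^sup>2)) =
        (\<Sum>k\<in>UNIV. complex_of_real (alpha k t)) - of_real lam * ?zz"
      unfolding sum_distrib_left sum_subtractf[symmetric] by (intro sum.cong refl) (simp add: algebra_simps)
    \<comment> \<open>The mean \<open>1 / lam\<close> is matched by the coefficient
      \<open>lam / 2\<close>, so the added term is free of \<open>lam\<close> and supplies the 1 in
      \<open>1 - lam * (norm (z $ k))\<^sup>2\<close>.\<close>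
    have "b - l / 2 * \<i> * x + l / 2 * \<i> * y = b + 1 / 2 * \<i> * (l * y - l * x)" for b l x y :: complex
      by (simp add: algebra_simps)
    then show ?thesis unfolding 2 1[symmetric] .
  qed
  finally show ?thesis
    using derived_rep_coherent(1)[where alpha = alpha, OF assms] berezin conv by blast
qed

end
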